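(* Let $\mathcal J$ be a generalized complex structure on an exact Courant algebroid $E$ over $M$ with anchor $\pi:E\to T$. The bivector field $P=\pi\circ\mathcal J|_{T^*}:T^*\to T$ is Poisson.
   Context: Let $T=TM$. On $T\oplus T^*$ use the inner product $\langle X+\xi,Y+\eta\rangle=\tfrac12(\xi(Y)+\eta(X))$, the projection $\pi:T\oplus T^*\to T$ (anchor) and, for a real closed 3-form $H$, the $H$-twisted Courant bracket $[X+\xi,Y+\eta]_H=[X,Y]+\mathcal L_X\eta-i_Yd\xi+i_Xi_YH$. An exact Courant algebroid $E$ over $M$ is a vector bundle with an inner product, a bracket on sections and a bundle map $\pi:E\to T$, sitting in an exact sequence $0\to T^*\to E\xrightarrow{\pi}T\to 0$ (so $T^*\subset E$), which after a choice of isotropic splitting of this sequence is identified with $(T\oplus T^*,\langle\cdot,\cdot\rangle,[\cdot,\cdot]_H,\pi)$ for some real closed $H$; isotropic splittings always exist. A generalized complex structure on $E$ is an endomorphism $\mathcal J:E\to E$ with $\mathcal J^2=-1$ whose $+i$-eigenbundle $L\subset E\otimes\mathbb C$ is involutive for the bracket; it is then orthogonal for the inner product, so $P$ is skew. A bivector field is Poisson when its Schouten bracket with itself vanishes. *)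

theory Defs
  imports "HOL-Analysis.Analysis"
begin

section \<open>Smooth manifolds\<close>

text \<open>
  Since the model space is finite-dimensional, a function is of class C^(k+1) on an open set iff
  it is differentiable there and all its directional derivatives are of class C^k.
\<close>

primrec Ck_on :: "nat \<Rightarrow> 'b::euclidean_space set \<Rightarrow> ('b \<Rightarrow> 'c::real_normed_vector) \<Rightarrow> bool" where
  "Ck_on 0 S f \<longleftrightarrow> continuous_on S f"
| "Ck_on (Suc k) S f \<longleftrightarrow>
     (\<forall>x\<in>S. f differentiable (at x)) \<and>
     (\<forall>v. Ck_on k S (\<lambda>x. frechet_derivative f (at x) v))"

definition smooth_on :: "'b::euclidean_space set \<Rightarrow> ('b \<Rightarrow> 'c::real_normed_vector) \<Rightarrow> bool" where
  "smooth_on S f \<longleftrightarrow> (\<forall>k. Ck_on k S f)"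

type_synonym ('m, 'b) chart = "'m set \<times> ('m \<Rightarrow> 'b)"

definition chart_inv :: "('m, 'b) chart \<Rightarrow> 'b \<Rightarrow> 'm" where
  "chart_inv c = inv_into (fst c) (snd c)"

text \<open>
  The points of the manifold are all the elements of the type \<open>'m\<close>, whose topology is that of the
  manifold; \<open>A\<close> is a smooth atlas, which need not be maximal.
\<close>

definition smooth_manifold ::
    "('m::{t2_space, second_countable_topology}, 'b::euclidean_space) chart set \<Rightarrow> bool" where
  "smooth_manifold A \<longleftrightarrow>
     (\<forall>c\<in>A. open (fst c) \<and> open (snd c ` fst c) \<and>
            homeomorphism (fst c) (snd c ` fst c) (snd c) (chart_inv c)) \<and>
     (\<Union>c\<in>A. fst c) = UNIV \<and>
     (\<forall>c\<in>A. \<forall>c'\<in>A. smooth_on (snd c ` (fst c \<inter> fst c')) (snd c' \<circ> chart_inv c))"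

definition smooth_fun ::
    "('m, 'b::euclidean_space) chart set \<Rightarrow> 'm set \<Rightarrow> ('m \<Rightarrow> 'c::real_normed_vector) \<Rightarrow> bool" where
  "smooth_fun A W g \<longleftrightarrow> (\<forall>c\<in>A. smooth_on (snd c ` (fst c \<inter> W)) (g \<circ> chart_inv c))"


section \<open>Vector bundles\<close>

text \<open>
  The fibres are linear subspaces of an ambient real vector space \<open>'e\<close>. This ambient space only
  serves to express the linear structure of the individual fibres: no relation between different
  fibres is implied, and fibres over different points may overlap. The smooth structure is given
  by the local trivialisations \<open>(U, t)\<close>, where \<open>t x\<close> maps the fibre over \<open>x \<in> U\<close> isomorphically
  to the typical fibre \<open>'f\<close>.
\<close>

record ('m, 'e, 'f) vbundle =
  fiber :: "'m \<Rightarrow> 'e set"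
  trivs :: "('m set \<times> ('m \<Rightarrow> 'e \<Rightarrow> 'f)) set"

definition linear_between ::
    "'e::real_vector set \<Rightarrow> 'g::real_vector set \<Rightarrow> ('e \<Rightarrow> 'g) \<Rightarrow> bool" where
  "linear_between V W h \<longleftrightarrow>
     h ` V \<subseteq> W \<and> (\<forall>u\<in>V. \<forall>v\<in>V. h (u + v) = h u + h v) \<and> (\<forall>r. \<forall>u\<in>V. h (r *\<^sub>R u) = r *\<^sub>R h u)"

definition bundle_map ::
    "('m, 'b::euclidean_space) chart set \<Rightarrow> ('m, 'e::real_vector, 'f::real_normed_vector) vbundle \<Rightarrow>
     ('m, 'g::real_vector, 'h::real_normed_vector) vbundle \<Rightarrow> ('m \<Rightarrow> 'e \<Rightarrow> 'g) \<Rightarrow> bool" where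
  "bundle_map A E F h \<longleftrightarrow>
     (\<forall>x. linear_between (fiber E x) (fiber F x) (h x)) \<and>
     (\<forall>(U, t)\<in>trivs E. \<forall>(V, s)\<in>trivs F. \<forall>w.
        smooth_fun A (U \<inter> V) (\<lambda>x. s x (h x (inv_into (fiber E x) (t x) w))))"

definition vector_bundle ::
    "('m::topological_space, 'b::euclidean_space) chart set \<Rightarrow>
     ('m, 'e::real_vector, 'f::real_normed_vector) vbundle \<Rightarrow> bool" where
  "vector_bundle A E \<longleftrightarrow>
     (\<exists>B::'f set. finite B \<and> span B = UNIV) \<and>
     (\<forall>x. subspace (fiber E x)) \<and>
     (\<forall>(U, t)\<in>trivs E. open U \<and>
        (\<forall>x\<in>U. linear_between (fiber E x) UNIV (t x) \<and> bij_betw (t x) (fiber E x) UNIV)) \<and>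
     (\<Union>(U, t)\<in>trivs E. U) = UNIV \<and>
     (\<forall>(U, t)\<in>trivs E. \<forall>(V, s)\<in>trivs E. \<forall>w.
        smooth_fun A (U \<inter> V) (\<lambda>x. s x (inv_into (fiber E x) (t x) w)))"

definition smooth_section ::
    "('m, 'b::euclidean_space) chart set \<Rightarrow> ('m, 'e::real_vector, 'f::real_normed_vector) vbundle \<Rightarrow>
     ('m \<Rightarrow> 'e) \<Rightarrow> bool" where
  "smooth_section A E \<sigma> \<longleftrightarrow>
     (\<forall>x. \<sigma> x \<in> fiber E x) \<and> (\<forall>(U, t)\<in>trivs E. smooth_fun A U (\<lambda>x. t x (\<sigma> x)))"


section \<open>Tangent and cotangent bundle\<close>

text \<open>
  A chart around each point is chosen once and for all, and the tangent space at \<open>x\<close> is identified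
  with the model space by means of the chart chosen at \<open>x\<close>. The tangent vector at \<open>x\<close> represented
  by \<open>v\<close> has the components \<open>coord_change (chart_at A x) c x v\<close> in any other chart \<open>c\<close> around \<open>x\<close>.
  Covectors at \<open>x\<close> are the linear forms on the tangent space.
\<close>

definition chart_at :: "('m, 'b) chart set \<Rightarrow> 'm \<Rightarrow> ('m, 'b) chart" where
  "chart_at A x = (SOME c. c \<in> A \<and> x \<in> fst c)"

definition coord_change ::
    "('m, 'b::euclidean_space) chart \<Rightarrow> ('m, 'b) chart \<Rightarrow> 'm \<Rightarrow> 'b \<Rightarrow>\<^sub>L 'b" where
  "coord_change c c' x = Blinfun (frechet_derivative (snd c' \<circ> chart_inv c) (at (snd c x)))"

definition tangent_bundle ::
    "('m, 'b::euclidean_space) chart set \<Rightarrow> ('m, 'b, 'b) vbundle" where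
  "tangent_bundle A =
     \<lparr> fiber = (\<lambda>x. UNIV),
       trivs = (\<lambda>c. (fst c, \<lambda>x v. coord_change (chart_at A x) c x v)) ` A \<rparr>"

definition cotangent_bundle ::
    "('m, 'b::euclidean_space) chart set \<Rightarrow> ('m, 'b \<Rightarrow>\<^sub>L real, 'b \<Rightarrow>\<^sub>L real) vbundle" where
  "cotangent_bundle A =
     \<lparr> fiber = (\<lambda>x. UNIV),
       trivs = (\<lambda>c. (fst c, \<lambda>x \<alpha>. \<alpha> o\<^sub>L coord_change c (chart_at A x) x)) ` A \<rparr>"

abbreviation vector_field ::
    "('m, 'b::euclidean_space) chart set \<Rightarrow> ('m \<Rightarrow> 'b) \<Rightarrow> bool" where
  "vector_field A X \<equiv> smooth_section A (tangent_bundle A) X"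

abbreviation one_form ::
    "('m, 'b::euclidean_space) chart set \<Rightarrow> ('m \<Rightarrow> 'b \<Rightarrow>\<^sub>L real) \<Rightarrow> bool" where
  "one_form A \<xi> \<equiv> smooth_section A (cotangent_bundle A) \<xi>"

text \<open>Components of tensor fields in a chart, as functions on the image of the chart.\<close>

definition vf_in ::
    "('m, 'b::euclidean_space) chart set \<Rightarrow> ('m, 'b) chart \<Rightarrow> ('m \<Rightarrow> 'b) \<Rightarrow> 'b \<Rightarrow> 'b" where
  "vf_in A c X y = (let x = chart_inv c y in coord_change (chart_at A x) c x (X x))"

definition form1_in ::
    "('m, 'b::euclidean_space) chart set \<Rightarrow> ('m, 'b) chart \<Rightarrow> ('m \<Rightarrow> 'b \<Rightarrow>\<^sub>L real) \<Rightarrow> 'b \<Rightarrow> 'b \<Rightarrow>\<^sub>L real"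
  where
  "form1_in A c \<xi> y = (let x = chart_inv c y in \<xi> x o\<^sub>L coord_change c (chart_at A x) x)"

definition form3_in ::
    "('m, 'b::euclidean_space) chart set \<Rightarrow> ('m, 'b) chart \<Rightarrow> ('m \<Rightarrow> 'b \<Rightarrow> 'b \<Rightarrow> 'b \<Rightarrow> real) \<Rightarrow>
     'b \<Rightarrow> 'b \<Rightarrow> 'b \<Rightarrow> 'b \<Rightarrow> real" where
  "form3_in A c H y u v w =
     (let x = chart_inv c y; d = coord_change c (chart_at A x) x in H x (d u) (d v) (d w))"

definition bivector_in ::
    "('m, 'b::euclidean_space) chart set \<Rightarrow> ('m, 'b) chart \<Rightarrow> ('m \<Rightarrow> ('b \<Rightarrow>\<^sub>L real) \<Rightarrow> 'b) \<Rightarrow>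
     'b \<Rightarrow> ('b \<Rightarrow>\<^sub>L real) \<Rightarrow> ('b \<Rightarrow>\<^sub>L real) \<Rightarrow> real" where
  "bivector_in A c P y \<alpha> \<beta> =
     (let x = chart_inv c y; d = coord_change (chart_at A x) c x in
        blinfun_apply \<beta> (d (P x (\<alpha> o\<^sub>L d))))"


section \<open>Differential operators on tensor fields\<close>

text \<open>
  The value at \<open>x\<close> of each operator is given by its usual coordinate formula in the chart chosen
  at \<open>x\<close>, in which the components of a tensor at \<open>x\<close> are those of its representing value.
\<close>

definition lie_bracket ::
    "('m, 'b::euclidean_space) chart set \<Rightarrow> ('m \<Rightarrow> 'b) \<Rightarrow> ('m \<Rightarrow> 'b) \<Rightarrow> 'm \<Rightarrow> 'b" where
  "lie_bracket A X Y x =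
     (let c = chart_at A x in
        frechet_derivative (vf_in A c Y) (at (snd c x)) (X x)
      - frechet_derivative (vf_in A c X) (at (snd c x)) (Y x))"

definition ext_deriv1 ::
    "('m, 'b::euclidean_space) chart set \<Rightarrow> ('m \<Rightarrow> 'b \<Rightarrow>\<^sub>L real) \<Rightarrow> 'm \<Rightarrow> 'b \<Rightarrow> 'b \<Rightarrow> real" where
  "ext_deriv1 A \<xi> x u v =
     (let c = chart_at A x; D = frechet_derivative (form1_in A c \<xi>) (at (snd c x)) in
        blinfun_apply (D u) v - blinfun_apply (D v) u)"

definition lie_deriv1 ::
    "('m, 'b::euclidean_space) chart set \<Rightarrow> ('m \<Rightarrow> 'b) \<Rightarrow> ('m \<Rightarrow> 'b \<Rightarrow>\<^sub>L real) \<Rightarrow> 'm \<Rightarrow> 'b \<Rightarrow> real" where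
  "lie_deriv1 A X \<eta> x v =
     (let c = chart_at A x in
        blinfun_apply (frechet_derivative (form1_in A c \<eta>) (at (snd c x)) (X x)) v
      + \<eta> x (frechet_derivative (vf_in A c X) (at (snd c x)) v))"

definition three_form ::
    "('m, 'b::euclidean_space) chart set \<Rightarrow> ('m \<Rightarrow> 'b \<Rightarrow> 'b \<Rightarrow> 'b \<Rightarrow> real) \<Rightarrow> bool" where
  "three_form A H \<longleftrightarrow>
     (\<forall>x u v w. linear (\<lambda>u. H x u v w) \<and> H x v u w = - H x u v w \<and> H x u w v = - H x u v w) \<and>
     (\<forall>c\<in>A. \<forall>u v w. smooth_on (snd c ` fst c) (\<lambda>y. form3_in A c H y u v w))"

definition ext_deriv3 ::
    "('m, 'b::euclidean_space) chart set \<Rightarrow> ('m \<Rightarrow> 'b \<Rightarrow> 'b \<Rightarrow> 'b \<Rightarrow> real) \<Rightarrow>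
     'm \<Rightarrow> 'b \<Rightarrow> 'b \<Rightarrow> 'b \<Rightarrow> 'b \<Rightarrow> real" where
  "ext_deriv3 A H x v0 v1 v2 v3 =
     (let c = chart_at A x;
          D = (\<lambda>v a b d. frechet_derivative (\<lambda>y. form3_in A c H y a b d) (at (snd c x)) v) in
        D v0 v1 v2 v3 - D v1 v0 v2 v3 + D v2 v0 v1 v3 - D v3 v0 v1 v2)"

definition closed_three_form ::
    "('m, 'b::euclidean_space) chart set \<Rightarrow> ('m \<Rightarrow> 'b \<Rightarrow> 'b \<Rightarrow> 'b \<Rightarrow> real) \<Rightarrow> bool" where
  "closed_three_form A H \<longleftrightarrow> three_form A H \<and> (\<forall>x v0 v1 v2 v3. ext_deriv3 A H x v0 v1 v2 v3 = 0)"


section \<open>Poisson bivector fields\<close>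

text \<open>
  A bivector field is a skew bundle map \<open>P\<close> from the cotangent to the tangent bundle, with
  \<open>P(\<alpha>, \<beta>) = \<beta> (P \<alpha>)\<close>.
\<close>

definition bivector_field ::
    "('m, 'b::euclidean_space) chart set \<Rightarrow> ('m \<Rightarrow> ('b \<Rightarrow>\<^sub>L real) \<Rightarrow> 'b) \<Rightarrow> bool" where
  "bivector_field A P \<longleftrightarrow>
     bundle_map A (cotangent_bundle A) (tangent_bundle A) P \<and>
     (\<forall>x \<alpha> \<beta>. blinfun_apply \<beta> (P x \<alpha>) = - blinfun_apply \<alpha> (P x \<beta>))"

text \<open>
  The Schouten bracket of two bivector fields, in coordinates
  \<open>[P,Q]^{ijk} = \<Sum>_l (P^{il} \<partial>_l Q^{jk} + Q^{il} \<partial>_l P^{jk}) + cyclic permutations of (i,j,k)\<close>.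
  This is what
  \<open>[X\<^sub>1 \<and> X\<^sub>2, Y\<^sub>1 \<and> Y\<^sub>2] = \<Sum>_{a,b} (-1)^{a+b} [X\<^sub>a, Y\<^sub>b] \<and> X\<^sub>{3-a} \<and> Y\<^sub>{3-b}\<close>
  gives for \<open>P = 1/2 \<Sum> P^{ij} \<partial>_i \<and> \<partial>_j\<close> and \<open>Q = 1/2 \<Sum> Q^{ij} \<partial>_i \<and> \<partial>_j\<close>.
\<close>

definition schouten_bracket ::
    "('m, 'b::euclidean_space) chart set \<Rightarrow> ('m \<Rightarrow> ('b \<Rightarrow>\<^sub>L real) \<Rightarrow> 'b) \<Rightarrow>
     ('m \<Rightarrow> ('b \<Rightarrow>\<^sub>L real) \<Rightarrow> 'b) \<Rightarrow>
     'm \<Rightarrow> ('b \<Rightarrow>\<^sub>L real) \<Rightarrow> ('b \<Rightarrow>\<^sub>L real) \<Rightarrow> ('b \<Rightarrow>\<^sub>L real) \<Rightarrow> real" where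
  "schouten_bracket A P Q x \<alpha> \<beta> \<gamma> =
     (let c = chart_at A x;
          D = (\<lambda>R v \<mu> \<nu>. frechet_derivative (\<lambda>y. bivector_in A c R y \<mu> \<nu>) (at (snd c x)) v);
          S = (\<lambda>\<kappa> \<mu> \<nu>. D Q (P x \<kappa>) \<mu> \<nu> + D P (Q x \<kappa>) \<mu> \<nu>) in
        S \<alpha> \<beta> \<gamma> + S \<beta> \<gamma> \<alpha> + S \<gamma> \<alpha> \<beta>)"

definition poisson_bivector ::
    "('m, 'b::euclidean_space) chart set \<Rightarrow> ('m \<Rightarrow> ('b \<Rightarrow>\<^sub>L real) \<Rightarrow> 'b) \<Rightarrow> bool" where
  "poisson_bivector A P \<longleftrightarrow>
     bivector_field A P \<and> (\<forall>x \<alpha> \<beta> \<gamma>. schouten_bracket A P P x \<alpha> \<beta> \<gamma> = 0)"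


section \<open>Exact Courant algebroids\<close>

text \<open>
  The one-form part of the \<open>H\<close>-twisted Courant bracket of \<open>X + \<xi>\<close> and \<open>Y + \<eta>\<close>; its vector part is
  the Lie bracket. Here \<open>i_X i_Y H = H(Y, X, \<cdot>)\<close>.
\<close>

definition courant_form_part ::
    "('m, 'b::euclidean_space) chart set \<Rightarrow> ('m \<Rightarrow> 'b \<Rightarrow> 'b \<Rightarrow> 'b \<Rightarrow> real) \<Rightarrow>
     ('m \<Rightarrow> 'b) \<Rightarrow> ('m \<Rightarrow> 'b \<Rightarrow>\<^sub>L real) \<Rightarrow> ('m \<Rightarrow> 'b) \<Rightarrow> ('m \<Rightarrow> 'b \<Rightarrow>\<^sub>L real) \<Rightarrow> 'm \<Rightarrow> 'b \<Rightarrow>\<^sub>L real"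
  where
  "courant_form_part A H X \<xi> Y \<eta> x =
     Blinfun (\<lambda>v. lie_deriv1 A X \<eta> x v - ext_deriv1 A \<xi> x (Y x) v + H x (Y x) (X x) v)"

definition bundle_inner_product ::
    "('m, 'b::euclidean_space) chart set \<Rightarrow> ('m, 'e::real_vector, 'f::real_normed_vector) vbundle \<Rightarrow>
     ('m \<Rightarrow> 'e \<Rightarrow> 'e \<Rightarrow> real) \<Rightarrow> bool" where
  "bundle_inner_product A E ip \<longleftrightarrow>
     (\<forall>x. (\<forall>u\<in>fiber E x. linear_between (fiber E x) UNIV (ip x u)) \<and>
          (\<forall>u\<in>fiber E x. \<forall>v\<in>fiber E x. ip x u v = ip x v u) \<and>
          (\<forall>u\<in>fiber E x. (\<forall>v\<in>fiber E x. ip x u v = 0) \<longrightarrow> u = 0)) \<and>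
     (\<forall>(U, t)\<in>trivs E. \<forall>w w'. smooth_fun A U
        (\<lambda>x. ip x (inv_into (fiber E x) (t x) w) (inv_into (fiber E x) (t x) w')))"

text \<open>
  In the following, \<open>ip\<close> is the (possibly indefinite) inner product, \<open>br\<close> the bracket on smooth
  sections, \<open>anc\<close> the anchor, and \<open>inc\<close> the inclusion of the cotangent bundle.
\<close>

definition isotropic_splitting ::
    "('m, 'b::euclidean_space) chart set \<Rightarrow> ('m, 'e::real_vector, 'f::real_normed_vector) vbundle \<Rightarrow>
     ('m \<Rightarrow> 'e \<Rightarrow> 'e \<Rightarrow> real) \<Rightarrow> ('m \<Rightarrow> 'e \<Rightarrow> 'b) \<Rightarrow> ('m \<Rightarrow> 'b \<Rightarrow> 'e) \<Rightarrow> bool" where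
  "isotropic_splitting A E ip anc s \<longleftrightarrow>
     bundle_map A (tangent_bundle A) E s \<and>
     (\<forall>x v. anc x (s x v) = v) \<and> (\<forall>x u v. ip x (s x u) (s x v) = 0)"

definition exact_courant_algebroid ::
    "('m::topological_space, 'b::euclidean_space) chart set \<Rightarrow>
     ('m, 'e::real_vector, 'f::real_normed_vector) vbundle \<Rightarrow> ('m \<Rightarrow> 'e \<Rightarrow> 'e \<Rightarrow> real) \<Rightarrow>
     (('m \<Rightarrow> 'e) \<Rightarrow> ('m \<Rightarrow> 'e) \<Rightarrow> 'm \<Rightarrow> 'e) \<Rightarrow> ('m \<Rightarrow> 'e \<Rightarrow> 'b) \<Rightarrow>
     ('m \<Rightarrow> ('b \<Rightarrow>\<^sub>L real) \<Rightarrow> 'e) \<Rightarrow> bool" where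
  "exact_courant_algebroid A E ip br anc inc \<longleftrightarrow>
     vector_bundle A E \<and>
     bundle_inner_product A E ip \<and>
     (\<forall>a b. smooth_section A E a \<and> smooth_section A E b \<longrightarrow> smooth_section A E (br a b)) \<and>
     bundle_map A E (tangent_bundle A) anc \<and>
     bundle_map A (cotangent_bundle A) E inc \<and>
     (\<forall>x. inj (inc x) \<and> range (inc x) = {e \<in> fiber E x. anc x e = 0} \<and>
          anc x ` fiber E x = UNIV) \<and>
     (\<exists>s H. isotropic_splitting A E ip anc s \<and> closed_three_form A H \<and>
        (\<forall>x X \<xi> Y \<eta>. ip x (s x X + inc x \<xi>) (s x Y + inc x \<eta>) =
            (1/2) * (blinfun_apply \<xi> Y + blinfun_apply \<eta> X)) \<and>
        (\<forall>X \<xi> Y \<eta>. vector_field A X \<and> one_form A \<xi> \<and> vector_field A Y \<and> one_form A \<eta> \<longrightarrow>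
           br (\<lambda>x. s x (X x) + inc x (\<xi> x)) (\<lambda>x. s x (Y x) + inc x (\<eta> x)) =
           (\<lambda>x. s x (lie_bracket A X Y x) + inc x (courant_form_part A H X \<xi> Y \<eta> x))))"


section \<open>Generalized complex structures\<close>

text \<open>
  A pair \<open>(a, b)\<close> of sections of \<open>E\<close> stands for the section \<open>a + i b\<close> of the complexification; the
  bracket is extended complex bilinearly. The condition \<open>\<J>(a + i b) = i (a + i b)\<close> reads
  \<open>\<J> a = -b\<close> and \<open>\<J> b = a\<close>.
\<close>

definition complex_bracket ::
    "(('m \<Rightarrow> 'e::real_vector) \<Rightarrow> ('m \<Rightarrow> 'e) \<Rightarrow> 'm \<Rightarrow> 'e) \<Rightarrow>
     ('m \<Rightarrow> 'e) \<times> ('m \<Rightarrow> 'e) \<Rightarrow> ('m \<Rightarrow> 'e) \<times> ('m \<Rightarrow> 'e) \<Rightarrow> ('m \<Rightarrow> 'e) \<times> ('m \<Rightarrow> 'e)" where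
  "complex_bracket br = (\<lambda>(a, b) (a', b').
     (\<lambda>x. br a a' x - br b b' x, \<lambda>x. br a b' x + br b a' x))"

definition eigenbundle_sections ::
    "('m, 'b::euclidean_space) chart set \<Rightarrow> ('m, 'e::real_vector, 'f::real_normed_vector) vbundle \<Rightarrow>
     ('m \<Rightarrow> 'e \<Rightarrow> 'e) \<Rightarrow> (('m \<Rightarrow> 'e) \<times> ('m \<Rightarrow> 'e)) set" where
  "eigenbundle_sections A E J =
     {(a, b). smooth_section A E a \<and> smooth_section A E b \<and>
              (\<forall>x. J x (a x) = - b x \<and> J x (b x) = a x)}"

definition generalized_complex_structure ::
    "('m, 'b::euclidean_space) chart set \<Rightarrow> ('m, 'e::real_vector, 'f::real_normed_vector) vbundle \<Rightarrow>
     (('m \<Rightarrow> 'e) \<Rightarrow> ('m \<Rightarrow> 'e) \<Rightarrow> 'm \<Rightarrow> 'e) \<Rightarrow> ('m \<Rightarrow> 'e \<Rightarrow> 'e) \<Rightarrow> bool" where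
  "generalized_complex_structure A E br J \<longleftrightarrow>
     bundle_map A E E J \<and>
     (\<forall>x. \<forall>e\<in>fiber E x. J x (J x e) = - e) \<and>
     (\<forall>\<sigma>\<in>eigenbundle_sections A E J. \<forall>\<tau>\<in>eigenbundle_sections A E J.
        complex_bracket br \<sigma> \<tau> \<in> eigenbundle_sections A E J)"

end

theory Submission
  imports Defs
begin

text \<open>
  For one-forms \<open>\<alpha>\<close> and \<open>\<beta>\<close>, the pairs \<open>(\<J>\<alpha>, \<alpha>)\<close> and \<open>(\<J>\<beta>, \<beta>)\<close> are sections of the
  \<open>+i\<close>-eigenbundle. The anchor of the involutivity condition for their bracket is the identity
  \<open>P (L\<^bsub>P\<alpha>\<^esub> \<beta> - i\<^bsub>P\<beta>\<^esub> d\<alpha>) = [P\<alpha>, P\<beta>]\<close>, in which the 3-form \<open>H\<close> no longer occurs.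
  Replacing \<open>\<alpha>\<close> by \<open>f \<alpha>\<close>, where \<open>f\<close> vanishes at \<open>x\<close>, leaves \<open>(\<beta>(P\<alpha>) + \<alpha>(P\<beta>)) P(df) = 0\<close> at
  \<open>x\<close>; as \<open>df\<close> is arbitrary, \<open>P\<close> is skew. For one-forms which have constant components to first
  order at \<open>x\<close>, the identity expresses, by skewness, the vanishing of the Schouten bracket.
\<close>

section \<open>Calculus of smooth functions\<close>

text \<open>The bracket and the involutivity condition speak of global smooth sections only, while
  the Schouten bracket is a local expression in one chart. Coordinate one-forms therefore have to be
  cut off and extended by zero. All operators involved are of first order, so a cut-off function
  with value 1 and derivative 0 at the point suffices; it need not be constant nearby. Skewness is
  derived from the identity because \<open>generalized_complex_structure\<close> does not postulate
  that \<open>J\<close> is orthogonal. The explicit bracket formula applies to a section only once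
  it is written as \<open>s X + inc \<xi>\<close> with smooth \<open>\<xi>\<close>. The section
  \<open>J \<alpha>\<close> is not given in this form, and the smoothness of its form part has to be
  extracted from the inner product. The typical fibre of \<open>E\<close> is merely a normed space
  with a finite spanning set, and smoothness of a bundle map is stated for fixed vectors of that
  space. Continuity of linear coordinates on such a space is thus the analytic basis for applying
  bundle maps to sections.\<close>

lemma frechet_derivativeI:
  "(f has_derivative f') (at x) \<Longrightarrow> frechet_derivative f (at x) = f'"
  by (rule frechet_derivative_at[symmetric])

lemma has_derivative_frechet:
  "f differentiable at x \<Longrightarrow> (f has_derivative frechet_derivative f (at x)) (at x)"
  by (simp add: frechet_derivative_works)

lemma Ck_on_cong:
  assumes "Ck_on k S f" "open S" "\<And>x. x \<in> S \<Longrightarrow> f x = g x"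
  shows "Ck_on k S g"
  using assms
proof (induction k arbitrary: f g)
  case 0
  then show ?case by (simp cong: continuous_on_cong)
next
  case (Suc k)
  have D: "(g has_derivative frechet_derivative f (at x)) (at x)" if "x \<in> S" for x
    using Suc.prems that
    by (intro has_derivative_transform_within_open[OF has_derivative_frechet, of f x S g]) auto
  then have "frechet_derivative g (at x) = frechet_derivative f (at x)" if "x \<in> S" for x
    using that by (blast intro: frechet_derivativeI)
  then have "Ck_on k S (\<lambda>x. frechet_derivative g (at x) v)" for v
    using Suc.prems Suc.IH[of "\<lambda>x. frechet_derivative f (at x) v"] by simp
  then show ?case using D by (auto intro: differentiableI)
qed

text \<open>Any explicit derivative may stand in for \<open>frechet_derivative\<close>: by
  uniqueness the two agree on the open set, and \<open>Ck_on_cong\<close> transfers the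
  regularity.\<close>

lemma Ck_on_SucI:
  assumes "open S" "\<And>x. x \<in> S \<Longrightarrow> (f has_derivative f' x) (at x)"
    and "\<And>v. Ck_on k S (\<lambda>x. f' x v)"
  shows "Ck_on (Suc k) S f"
proof -
  have "Ck_on k S (\<lambda>x. frechet_derivative f (at x) v)" for v
    using assms by (intro Ck_on_cong[OF assms(3)[of v]]) (simp_all add: frechet_derivativeI[OF assms(2)])
  then show ?thesis using assms(2) by (auto intro: differentiableI)
qed

lemma Ck_on_SucD: "Ck_on (Suc k) S f \<Longrightarrow> Ck_on k S f"
proof (induction k arbitrary: f)
  case 0
  then show ?case
    by (simp add: differentiable_imp_continuous_on differentiable_at_imp_differentiable_on)
next
  case (Suc k)
  have "Ck_on k S (\<lambda>x. frechet_derivative f (at x) v)" for v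
    using Suc.prems by (intro Suc.IH) (subst (asm) Ck_on.simps(2), blast)
  then show ?case using Suc.prems by (subst Ck_on.simps(2)) (subst (asm) Ck_on.simps(2), blast)
qed

lemma Ck_on_subset: "Ck_on k T f \<Longrightarrow> S \<subseteq> T \<Longrightarrow> Ck_on k S f"
  by (induction k arbitrary: f) (auto intro: continuous_on_subset)

lemma Ck_on_local:
  assumes "\<And>x. x \<in> S \<Longrightarrow> \<exists>T. open T \<and> x \<in> T \<and> Ck_on k T f"
  shows "Ck_on k S f"
  using assms
proof (induction k arbitrary: f)
  case 0
  have "isCont f x" if x: "x \<in> S" for x
  proof -
    obtain T where "open T" "x \<in> T" "continuous_on T f" using 0[OF x] by auto
    then show ?thesis by (simp add: continuous_on_eq_continuous_at)
  qed
  then show ?case by (simp add: continuous_at_imp_continuous_on)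
next
  case (Suc k)
  have "Ck_on k S (\<lambda>x. frechet_derivative f (at x) v)" for v
  proof (rule Suc.IH)
    fix x assume "x \<in> S"
    then obtain T where "open T" "x \<in> T" "Ck_on (Suc k) T f" using Suc.prems by blast
    then show "\<exists>T. open T \<and> x \<in> T \<and> Ck_on k T (\<lambda>x. frechet_derivative f (at x) v)"
      by (intro exI[of _ T]) simp
  qed
  moreover have "f differentiable at x" if x: "x \<in> S" for x
  proof -
    obtain T where "x \<in> T" "Ck_on (Suc k) T f" using Suc.prems[OF x] by blast
    then show ?thesis by simp
  qed
  ultimately show ?case by simp
qed

lemma Ck_on_const: "Ck_on k S (\<lambda>x. c)"
  by (induction k arbitrary: c) (auto simp: continuous_on_const)

lemma Ck_on_linear:
  assumes "bounded_linear f" "open S"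
  shows "Ck_on k S f"
proof (cases k)
  case 0
  then show ?thesis using assms by (simp add: linear_continuous_on)
next
  case (Suc n)
  show ?thesis unfolding Suc
    by (rule Ck_on_SucI[OF assms(2)])
       (use assms bounded_linear_imp_has_derivative Ck_on_const in auto)
qed

lemma Ck_on_add:
  assumes "open S" "Ck_on k S f" "Ck_on k S g"
  shows "Ck_on k S (\<lambda>x. f x + g x)"
  using assms(2,3)
proof (induction k arbitrary: f g)
  case 0
  then show ?case by (auto intro: continuous_intros)
next
  case (Suc k)
  show ?case
    by (rule Ck_on_SucI[OF assms(1)], rule has_derivative_add)
       (use Suc in \<open>auto intro: has_derivative_frechet\<close>)
qed

text \<open>Leibniz rule: each summand of the derivative contains one undifferentiated factor, which
  is lowered by one order with \<open>Ck_on_SucD\<close> before the induction hypothesis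
  applies.\<close>

lemma Ck_on_bilinear:
  assumes "bounded_bilinear h" "open S" "Ck_on k S f" "Ck_on k S g"
  shows "Ck_on k S (\<lambda>x. h (f x) (g x))"
  using assms(3,4)
proof (induction k arbitrary: f g)
  case 0
  then show ?case
    using bounded_bilinear.continuous_on[OF assms(1)] by auto
next
  case (Suc k)
  show ?case
  proof (rule Ck_on_SucI[OF assms(2)])
    fix x assume "x \<in> S"
    then show "((\<lambda>x. h (f x) (g x)) has_derivative
        (\<lambda>v. h (f x) (frechet_derivative g (at x) v) + h (frechet_derivative f (at x) v) (g x))) (at x)"
      using Suc.prems
      by (intro bounded_bilinear.FDERIV[OF assms(1)] has_derivative_frechet) auto
  next
    fix v
    show "Ck_on k S (\<lambda>x. h (f x) (frechet_derivative g (at x) v) + h (frechet_derivative f (at x) v) (g x))"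
      using Suc by (intro Ck_on_add[OF assms(2)] Suc.IH) (auto intro: Ck_on_SucD)
  qed
qed

lemma Ck_on_linear_compose:
  assumes "bounded_linear h" "open S" "Ck_on k S f"
  shows "Ck_on k S (\<lambda>x. h (f x))"
proof -
  \<comment> \<open>A linear map is the bilinear map \<open>r *\<^sub>R h x\<close> at the constant
    \<open>r = 1\<close>, so the induction for products covers this case.\<close>
  interpret bounded_bilinear "\<lambda>(r::real) x. r *\<^sub>R h x"
    using bounded_bilinear.comp[OF bounded_bilinear_scaleR bounded_linear_ident assms(1)] .
  show ?thesis
    using Ck_on_bilinear[OF bounded_bilinear_axioms assms(2) Ck_on_const[of k S 1] assms(3)] by simp
qed

lemma Ck_on_sum:
  assumes "open S" "\<And>i. i \<in> I \<Longrightarrow> Ck_on k S (f i)"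
  shows "Ck_on k S (\<lambda>x. \<Sum>i\<in>I. f i x)"
  using assms(2)
  by (induction I rule: infinite_finite_induct) (auto intro: Ck_on_const Ck_on_add[OF assms(1)])

lemma linear_eq_sum_Basis:
  fixes h :: "'b::euclidean_space \<Rightarrow> 'c::real_vector"
  assumes "linear h"
  shows "h w = (\<Sum>b\<in>Basis. (w \<bullet> b) *\<^sub>R h b)"
proof -
  have "h (\<Sum>b\<in>Basis. (w \<bullet> b) *\<^sub>R b) = (\<Sum>b\<in>Basis. (w \<bullet> b) *\<^sub>R h b)"
    using assms by (simp add: linear_sum linear_cmul)
  then show ?thesis by (simp only: euclidean_representation)
qed

text \<open>In the chain rule both the base point \<open>f x\<close> and the direction
  \<open>f' v\<close> vary with \<open>x\<close>, whereas \<open>Ck_on\<close> controls derivatives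
  in fixed directions only. Expanding the direction in \<open>Basis\<close> separates the two:
  fixed-direction derivatives of \<open>g\<close> along \<open>f\<close>, to which the induction
  hypothesis applies, times smooth coefficients.\<close>

lemma Ck_on_compose:
  fixes f :: "'a::euclidean_space \<Rightarrow> 'b::euclidean_space" and g :: "'b \<Rightarrow> 'c::real_normed_vector"
  assumes "open S" "open T" "f ` S \<subseteq> T" "Ck_on k S f" "Ck_on k T g"
  shows "Ck_on k S (\<lambda>x. g (f x))"
  using assms(4,5)
proof (induction k arbitrary: g)
  case 0
  then show ?case by (simp add: continuous_on_compose2[OF _ _ assms(3)])
next
  case (Suc k)
  show ?case
  proof (rule Ck_on_SucI[OF assms(1)])
    fix x assume x: "x \<in> S"
    let ?f' = "frechet_derivative f (at x)" and ?g' = "frechet_derivative g (at (f x))"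
    have g': "(g has_derivative ?g') (at (f x))"
      using Suc.prems assms(3) x by (auto intro!: has_derivative_frechet)
    then have "linear ?g'" by (simp add: has_derivative_linear)
    then have eq: "(\<lambda>v. ?g' (?f' v)) = (\<lambda>v. \<Sum>b\<in>Basis. (?f' v \<bullet> b) *\<^sub>R ?g' b)"
      by (intro ext linear_eq_sum_Basis)
    have D: "((\<lambda>x. g (f x)) has_derivative (\<lambda>v. ?g' (?f' v))) (at x)"
      using Suc.prems x by (intro has_derivative_compose[of f ?f' x UNIV g ?g', OF _ g'] has_derivative_frechet) auto
    show "((\<lambda>x. g (f x)) has_derivative
        (\<lambda>v. \<Sum>b\<in>Basis. (?f' v \<bullet> b) *\<^sub>R ?g' b)) (at x)"
      by (rule D[unfolded eq])
  next
    fix v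
    have "Ck_on k S (\<lambda>x. frechet_derivative f (at x) v \<bullet> b)" for b
      using Suc.prems by (intro Ck_on_linear_compose[OF bounded_linear_inner_left assms(1)]) simp
    moreover have "Ck_on k S (\<lambda>x. frechet_derivative g (at (f x)) b)" for b
      using Suc.prems by (intro Suc.IH) (auto intro: Ck_on_SucD)
    ultimately show "Ck_on k S
      (\<lambda>x. \<Sum>b\<in>Basis. (frechet_derivative f (at x) v \<bullet> b) *\<^sub>R frechet_derivative g (at (f x)) b)"
      by (intro Ck_on_sum Ck_on_bilinear[OF bounded_bilinear_scaleR] assms(1))
  qed
qed

section \<open>Closure properties of smooth functions, order by order\<close>

lemma smooth_on_cong:
  "smooth_on S f \<Longrightarrow> open S \<Longrightarrow> (\<And>x. x \<in> S \<Longrightarrow> f x = g x) \<Longrightarrow> smooth_on S g"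
  unfolding smooth_on_def by (blast intro: Ck_on_cong)

lemma smooth_on_subset: "smooth_on T f \<Longrightarrow> S \<subseteq> T \<Longrightarrow> smooth_on S f"
  unfolding smooth_on_def by (blast intro: Ck_on_subset)

lemma smooth_on_local:
  "(\<And>x. x \<in> S \<Longrightarrow> \<exists>T. open T \<and> x \<in> T \<and> smooth_on T f) \<Longrightarrow> smooth_on S f"
  unfolding smooth_on_def by (meson Ck_on_local)

lemma smooth_on_const: "smooth_on S (\<lambda>x. c)"
  unfolding smooth_on_def by (blast intro: Ck_on_const)

lemma smooth_on_linear: "bounded_linear f \<Longrightarrow> open S \<Longrightarrow> smooth_on S f"
  unfolding smooth_on_def by (blast intro: Ck_on_linear)

lemma smooth_on_add:
  "open S \<Longrightarrow> smooth_on S f \<Longrightarrow> smooth_on S g \<Longrightarrow> smooth_on S (\<lambda>x. f x + g x)"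
  unfolding smooth_on_def by (blast intro: Ck_on_add)

lemma smooth_on_bilinear:
  "bounded_bilinear h \<Longrightarrow> open S \<Longrightarrow> smooth_on S f \<Longrightarrow> smooth_on S g \<Longrightarrow>
    smooth_on S (\<lambda>x. h (f x) (g x))"
  unfolding smooth_on_def by (blast intro: Ck_on_bilinear)

lemma smooth_on_linear_compose:
  "bounded_linear h \<Longrightarrow> open S \<Longrightarrow> smooth_on S f \<Longrightarrow> smooth_on S (\<lambda>x. h (f x))"
  unfolding smooth_on_def by (blast intro: Ck_on_linear_compose)

lemma smooth_on_sum:
  "open S \<Longrightarrow> (\<And>i. i \<in> I \<Longrightarrow> smooth_on S (f i)) \<Longrightarrow> smooth_on S (\<lambda>x. \<Sum>i\<in>I. f i x)"
  unfolding smooth_on_def by (blast intro: Ck_on_sum)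

lemma smooth_on_compose:
  fixes f :: "'a::euclidean_space \<Rightarrow> 'b::euclidean_space" and g :: "'b \<Rightarrow> 'c::real_normed_vector"
  shows "smooth_on S f \<Longrightarrow> smooth_on T g \<Longrightarrow> open S \<Longrightarrow> open T \<Longrightarrow> f ` S \<subseteq> T \<Longrightarrow>
    smooth_on S (\<lambda>x. g (f x))"
  unfolding smooth_on_def by (blast intro: Ck_on_compose)

lemma smooth_on_differentiable: "smooth_on S f \<Longrightarrow> x \<in> S \<Longrightarrow> f differentiable at x"
  unfolding smooth_on_def by (metis Ck_on.simps(2))

lemma smooth_on_derivative: "smooth_on S f \<Longrightarrow> smooth_on S (\<lambda>x. frechet_derivative f (at x) v)"
  unfolding smooth_on_def by (metis Ck_on.simps(2))


section \<open>Finite-dimensional normed spaces\<close>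

text \<open>The compact set of all combinations of \<open>B\<close> with largest coefficient 1 avoids 0.\<close>

lemma independent_coeff_bound:
  fixes B :: "'f::real_normed_vector set"
  assumes B: "finite B" "independent B"
  shows "\<exists>\<delta>>0. \<forall>c. \<forall>b\<in>B. \<delta> * \<bar>c b\<bar> \<le> norm (\<Sum>b\<in>B. c b *\<^sub>R b)"
proof -
  define comb where "comb C = {\<Sum>b\<in>C. c b *\<^sub>R b |c. \<forall>b\<in>C. \<bar>c b\<bar> \<le> (1::real)}" for C :: "'f set"
  \<comment> \<open>Adding a vector \<open>d\<close> to \<open>C\<close> turns \<open>comb C\<close>
    into its Minkowski sum with the segment from \<open>- d\<close> to \<open>d\<close>.\<close>
  have comp: "compact (comb C)" if "finite C" for C
    using that
  proof induction
    case empty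
    have "comb {} = {0}" by (auto simp: comb_def)
    then show ?case by simp
  next
    case (insert d C)
    let ?S = "\<Union>u\<in>(\<lambda>r. r *\<^sub>R d) ` {-1..1}. \<Union>v\<in>comb C. {u + v}"
    have "compact ?S"
      by (intro compact_sums' insert.IH compact_continuous_image continuous_intros compact_Icc)
    moreover have "comb (insert d C) = ?S"
    proof (intro set_eqI iffI)
      fix z assume "z \<in> comb (insert d C)"
      then obtain c where c: "z = (\<Sum>b\<in>insert d C. c b *\<^sub>R b)" "\<forall>b\<in>insert d C. \<bar>c b\<bar> \<le> 1"
        unfolding comb_def by blast
      then have "z = c d *\<^sub>R d + (\<Sum>b\<in>C. c b *\<^sub>R b)" using insert by simp
      moreover have "(\<Sum>b\<in>C. c b *\<^sub>R b) \<in> comb C" "c d *\<^sub>R d \<in> (\<lambda>r. r *\<^sub>R d) ` {-1..1}"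
        using c by (auto simp: comb_def abs_le_iff)
      ultimately show "z \<in> ?S" by blast
    next
      fix z assume "z \<in> ?S"
      then obtain r c where r: "\<bar>r\<bar> \<le> 1" "\<forall>b\<in>C. \<bar>c b\<bar> \<le> 1" and
        z: "z = r *\<^sub>R d + (\<Sum>b\<in>C. c b *\<^sub>R b)"
        unfolding comb_def by (auto simp: abs_le_iff)
      have "(\<Sum>b\<in>C. c b *\<^sub>R b) = (\<Sum>b\<in>C. (c(d := r)) b *\<^sub>R b)"
        using insert by (intro sum.cong) auto
      then have "z = (\<Sum>b\<in>insert d C. (c(d := r)) b *\<^sub>R b)" using z insert by simp
      moreover have "\<forall>b\<in>insert d C. \<bar>(c(d := r)) b\<bar> \<le> 1" using r by auto
      ultimately show "z \<in> comb (insert d C)" unfolding comb_def by blast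
    qed
    ultimately show ?case by simp
  qed
  \<comment> \<open>The boundary of the coefficient cube, face by face: the coefficient of
    \<open>b\<close> is 1 or -1, the others are at most 1 in absolute value.\<close>
  define Z where "Z = (\<Union>b\<in>B. \<Union>s\<in>{-1,1}. (\<lambda>u. s *\<^sub>R b + u) ` comb (B - {b}))"
  have "compact Z"
    unfolding Z_def using B by (auto intro!: compact_UN compact_continuous_image comp continuous_intros)
  have ZI: "(\<Sum>b\<in>B. c b *\<^sub>R b) \<in> Z"
    if "b0 \<in> B" "\<bar>c b0\<bar> = 1" "\<forall>b\<in>B. \<bar>c b\<bar> \<le> 1" for b0 c
  proof -
    have "(\<Sum>b\<in>B. c b *\<^sub>R b) = c b0 *\<^sub>R b0 + (\<Sum>b\<in>B - {b0}. c b *\<^sub>R b)"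
      using that B by (simp add: sum.remove)
    moreover have "(\<Sum>b\<in>B - {b0}. c b *\<^sub>R b) \<in> comb (B - {b0})"
      unfolding comb_def using that(3) by (intro CollectI exI[of _ c]) simp
    moreover have "c b0 \<in> {-1, 1}" using that by (auto simp: abs_if split: if_splits)
    ultimately show ?thesis unfolding Z_def using that(1) by (intro UN_I[of b0] UN_I[of "c b0"]) auto
  qed
  have "0 \<notin> Z"
  proof
    assume "0 \<in> Z"
    then obtain b s c where b: "b \<in> B" "s \<in> {-1, 1::real}"
      and eq: "0 = s *\<^sub>R b + (\<Sum>a\<in>B - {b}. c a *\<^sub>R a)"
      unfolding Z_def comb_def by blast
    have "(\<Sum>a\<in>B. (c(b := s)) a *\<^sub>R a) = s *\<^sub>R b + (\<Sum>a\<in>B - {b}. (c(b := s)) a *\<^sub>R a)"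
      using b B by (simp add: sum.remove)
    also have "(\<Sum>a\<in>B - {b}. (c(b := s)) a *\<^sub>R a) = (\<Sum>a\<in>B - {b}. c a *\<^sub>R a)"
      by (intro sum.cong) auto
    finally have "(\<Sum>a\<in>B. (c(b := s)) a *\<^sub>R a) = 0" using eq by simp
    then have "(c(b := s)) b = 0"
      by (rule independentD[OF B(2,1) order_refl _ b(1)])
    then show False using b by auto
  qed
  obtain \<delta> where \<delta>: "\<delta> > 0" "\<And>z. z \<in> Z \<Longrightarrow> \<delta> \<le> norm z"
  proof -
    have "open (- Z)" using \<open>compact Z\<close> compact_imp_closed by blast
    then obtain \<delta> where "\<delta> > 0" "ball 0 \<delta> \<subseteq> - Z"
      using \<open>0 \<notin> Z\<close> by (meson ComplI open_contains_ball)
    then show ?thesis by (intro that[of \<delta>]) (auto simp: subset_iff not_le[symmetric])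
  qed
  have "\<delta> * \<bar>c b\<bar> \<le> norm (\<Sum>b\<in>B. c b *\<^sub>R b)" if b: "b \<in> B" for c b
  proof -
    \<comment> \<open>By homogeneity: dividing by the largest coefficient \<open>m\<close> moves the
      combination into \<open>Z\<close>.\<close>
    define m where "m = Max ((\<lambda>b. \<bar>c b\<bar>) ` B)"
    have "m \<in> (\<lambda>b. \<bar>c b\<bar>) ` B" unfolding m_def using B b by (intro Max_in) auto
    then obtain b0 where b0: "b0 \<in> B" "\<bar>c b0\<bar> = m" by auto
    have le: "\<bar>c a\<bar> \<le> m" if "a \<in> B" for a unfolding m_def using B that by simp
    show ?thesis
    proof (cases "m = 0")
      case True
      then show ?thesis using le[OF b] by simp
    next
      case False
      then have m: "m > 0" using b0 by auto
      have "(\<Sum>b\<in>B. (c b / m) *\<^sub>R b) \<in> Z"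
        using b0 le m by (intro ZI[of b0]) auto
      then have "\<delta> \<le> norm (\<Sum>b\<in>B. (c b / m) *\<^sub>R b)" by (rule \<delta>)
      also have "(\<Sum>b\<in>B. (c b / m) *\<^sub>R b) = (1 / m) *\<^sub>R (\<Sum>b\<in>B. c b *\<^sub>R b)"
        by (simp add: scaleR_sum_right)
      finally have "\<delta> \<le> norm (\<Sum>b\<in>B. c b *\<^sub>R b) / m" using m by simp
      then have "\<delta> * m \<le> norm (\<Sum>b\<in>B. c b *\<^sub>R b)" using m by (simp only: pos_le_divide_eq)
      moreover have "\<delta> * \<bar>c b\<bar> \<le> \<delta> * m" using le[OF b] \<delta> by simp
      ultimately show ?thesis by linarith
    qed
  qed
  then show ?thesis using \<delta>(1) by blast
qed

text \<open>The coordinates with respect to a basis contained in \<open>B\<close> are bounded by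
  \<open>1 / \<delta>\<close>, with \<open>\<delta>\<close> from
  \<open>independent_coeff_bound\<close>. This stands in for an orthonormal basis on a space without
  inner product.\<close>

lemma finite_dim_coordinates:
  fixes B :: "'f::real_normed_vector set"
  assumes "finite B" "span B = UNIV"
  shows "\<exists>C (\<phi> :: 'f \<Rightarrow> 'f \<Rightarrow> real). finite C \<and> (\<forall>b\<in>C. bounded_linear (\<phi> b)) \<and>
    (\<forall>w. (\<Sum>b\<in>C. \<phi> b w *\<^sub>R b) = w)"
proof -
  obtain C where C: "C \<subseteq> B" "independent C" "span C = span B"
    by (metis maximal_independent_subset span_eq_iff span_minimal span_mono subspace_span subset_antisym)
  have fC: "finite C" using C assms finite_subset by blast
  have sp: "w \<in> span C" for w using C assms by simp
  let ?\<phi> = "\<lambda>b w. representation C w b"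
  have sum: "(\<Sum>b\<in>C. ?\<phi> b w *\<^sub>R b) = w" for w
    by (rule sum_representation_eq[OF C(2) sp fC order_refl])
  obtain \<delta> where \<delta>: "\<delta> > 0" "\<And>c b. b \<in> C \<Longrightarrow> \<delta> * \<bar>c b\<bar> \<le> norm (\<Sum>b\<in>C. c b *\<^sub>R b)"
    using independent_coeff_bound[OF fC C(2)] by blast
  have "bounded_linear (?\<phi> b)" if "b \<in> C" for b
  proof (rule bounded_linear_intro)
    show "norm (?\<phi> b w) \<le> norm w * (1 / \<delta>)" for w
      using \<delta>(2)[OF that, of "\<lambda>b. ?\<phi> b w"] \<delta>(1) by (simp add: sum field_simps)
  qed (simp_all add: representation_add[OF C(2) sp sp] representation_scale[OF C(2) sp])
  with fC sum show ?thesis by (intro exI[of _ C] exI[of _ ?\<phi>]) simp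
qed

text \<open>Bridges the definition of bundle maps, which tests smoothness on constant vectors
  \<open>w\<close>, and their application to sections, where the argument \<open>g x\<close> varies:
  expand \<open>g x\<close> in continuous coordinates.\<close>

lemma smooth_on_linear_family:
  fixes h :: "'a::euclidean_space \<Rightarrow> 'f::real_normed_vector \<Rightarrow> 'g::real_normed_vector"
  assumes fin: "\<exists>B. finite B \<and> span B = (UNIV :: 'f set)" and S: "open S"
    and lin: "\<And>x. x \<in> S \<Longrightarrow> linear (h x)"
    and h: "\<And>w. smooth_on S (\<lambda>x. h x w)" and g: "smooth_on S g"
  shows "smooth_on S (\<lambda>x. h x (g x))"
proof -
  obtain C and \<phi> :: "'f \<Rightarrow> 'f \<Rightarrow> real" where C: "finite C" "\<And>b. b \<in> C \<Longrightarrow> bounded_linear (\<phi> b)"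
    "\<And>w. (\<Sum>b\<in>C. \<phi> b w *\<^sub>R b) = w"
    using fin finite_dim_coordinates by metis
  have "smooth_on S (\<lambda>x. \<Sum>b\<in>C. \<phi> b (g x) *\<^sub>R h x b)"
    by (intro smooth_on_sum smooth_on_bilinear[OF bounded_bilinear_scaleR] 
        smooth_on_linear_compose[OF C(2)] S h g)
  moreover have "(\<Sum>b\<in>C. \<phi> b (g x) *\<^sub>R h x b) = h x (g x)" if "x \<in> S" for x
  proof -
    have "(\<Sum>b\<in>C. \<phi> b (g x) *\<^sub>R h x b) = h x (\<Sum>b\<in>C. \<phi> b (g x) *\<^sub>R b)"
      using lin[OF that] by (simp add: linear_sum linear_cmul)
    then show ?thesis by (simp only: C(3))
  qed
  ultimately show ?thesis by (rule smooth_on_cong[OF _ S])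
qed

lemma blinfun_real_eq_sum:
  fixes w :: "'b::euclidean_space \<Rightarrow>\<^sub>L real"
  shows "(\<Sum>b\<in>Basis. w b *\<^sub>R blinfun_inner_left b) = w"
proof (rule blinfun_euclidean_eqI)
  fix i :: 'b assume "i \<in> Basis"
  then show "(\<Sum>b\<in>Basis. w b *\<^sub>R blinfun_inner_left b) i = w i"
    by (simp add: blinfun.sum_left blinfun.scaleR_left blinfun_inner_left.rep_eq inner_Basis
        if_distrib cong: if_cong)
qed

lemma finite_dim_euclidean:
  "\<exists>B. finite B \<and> span B = (UNIV :: 'b::euclidean_space set)"
  using finite_Basis span_Basis by blast

lemma finite_dim_dual:
  "\<exists>B. finite B \<and> span B = (UNIV :: ('b::euclidean_space \<Rightarrow>\<^sub>L real) set)"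
proof (intro exI conjI)
  let ?B = "blinfun_inner_left ` (Basis :: 'b set)"
  show "finite ?B" by simp
  have "(\<Sum>b\<in>Basis. w b *\<^sub>R blinfun_inner_left b) \<in> span ?B" for w :: "'b \<Rightarrow>\<^sub>L real"
    by (intro span_sum span_scale span_base) simp
  then show "span ?B = UNIV" by (metis UNIV_eq_I blinfun_real_eq_sum)
qed

text \<open>A covector is a combination of the constant dual basis with its values on
  \<open>Basis\<close> as coefficients, so it can be tested on fixed vectors.\<close>

lemma smooth_on_blinfun_real:
  fixes f :: "'a::euclidean_space \<Rightarrow> 'b::euclidean_space \<Rightarrow>\<^sub>L real"
  assumes "open S" "\<And>v. smooth_on S (\<lambda>x. f x v)"
  shows "smooth_on S f"
proof -
  have "smooth_on S (\<lambda>x. \<Sum>b\<in>Basis. f x b *\<^sub>R blinfun_inner_left b)"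
    using assms by (intro smooth_on_sum smooth_on_bilinear[OF bounded_bilinear_scaleR] smooth_on_const)
  then show ?thesis by (simp only: blinfun_real_eq_sum)
qed

section \<open>Bump functions\<close>

text \<open>The exponent \<open>n\<close> makes the span of these functions closed under differentiation.\<close>

definition flat_exp :: "nat \<Rightarrow> real \<Rightarrow> real" where
  "flat_exp n t = (if t \<le> 0 then 0 else inverse t ^ n * exp (- inverse t))"

text \<open>From the right, substitute \<open>u = inverse t\<close>: the exponential outgrows the
  power. From the left the function is zero.\<close>

lemma flat_exp_tendsto_0: "(flat_exp n \<longlongrightarrow> 0) (at 0)"
proof -
  have "((\<lambda>t. inverse t ^ n / exp (inverse t)) \<longlongrightarrow> (0::real)) (at_right 0)"
    by (rule filterlim_compose[OF tendsto_power_div_exp_0 filterlim_inverse_at_top_right])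
  then have "(flat_exp n \<longlongrightarrow> 0) (at_right 0)"
    by (rule Lim_transform_eventually)
      (auto simp: eventually_at_filter flat_exp_def exp_minus divide_inverse)
  moreover have "(flat_exp n \<longlongrightarrow> 0) (at_left 0)"
    by (rule Lim_transform_eventually[OF tendsto_const])
      (auto simp: eventually_at_filter flat_exp_def)
  ultimately show ?thesis by (simp add: filterlim_at_split)
qed

lemma flat_exp_deriv:
  "(flat_exp n has_real_derivative flat_exp (n + 2) t - n * flat_exp (n + 1) t) (at t)"
proof -
  consider "t < 0" | "t = 0" | "t > 0" by linarith
  then show ?thesis
  proof cases
    case 1
    have "((\<lambda>t. 0) has_real_derivative flat_exp (n + 2) t - n * flat_exp (n + 1) t) (at t)"
      using 1 by (simp add: flat_exp_def)
    then show ?thesis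
      by (rule has_field_derivative_transform_within_open[of _ _ _ "{..<0}"])
        (use 1 in \<open>auto simp: flat_exp_def\<close>)
  next
    case 2
    \<comment> \<open>Dividing by \<open>h\<close> raises the exponent by one, so the difference
      quotient at 0 is itself a flat function and tends to 0. At \<open>h = 0\<close> both sides are
      0 because division by zero yields 0.\<close>
    have "(\<lambda>h. (flat_exp n (0 + h) - flat_exp n 0) / h) = flat_exp (n + 1)"
      by (auto simp: flat_exp_def fun_eq_iff field_simps)
    then show ?thesis
      using flat_exp_tendsto_0[of "n + 1"] 2 unfolding DERIV_def by (simp add: flat_exp_def)
  next
    case 3
    have pow: "((\<lambda>t. inverse t ^ n) has_real_derivative - (n * inverse t ^ (n + 1))) (at t)"
      by (rule DERIV_cong[OF DERIV_power[OF DERIV_inverse]])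
        (use 3 in \<open>cases n; simp add: power2_eq_square\<close>)+
    have "((\<lambda>t. inverse t ^ n * exp (- inverse t)) has_real_derivative
        flat_exp (n + 2) t - n * flat_exp (n + 1) t) (at t)"
      by (rule derivative_eq_intros pow refl)+
        (use 3 in \<open>auto simp: flat_exp_def power2_eq_square algebra_simps\<close>)
    then show ?thesis
      by (rule has_field_derivative_transform_within_open[of _ _ _ "{0<..}"])
        (use 3 in \<open>auto simp: flat_exp_def\<close>)
  qed
qed

lemma smooth_on_flat_exp: "smooth_on UNIV (flat_exp n)"
proof -
  have "Ck_on k UNIV (flat_exp n)" for k
  proof (induction k arbitrary: n)
    case 0
    show ?case using DERIV_isCont[OF flat_exp_deriv] by (simp add: continuous_at_imp_continuous_on)
  next
    case (Suc k)
    have *: "bounded_linear (\<lambda>r. r * c)" for c :: real by (rule bounded_linear_mult_left)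
    \<comment> \<open>Written as a sum of flat functions times constants, so that the induction
      hypothesis for \<open>n + 2\<close> and \<open>n + 1\<close> applies.\<close>
    let ?f' = "\<lambda>t v. flat_exp (n + 2) t * v + flat_exp (n + 1) t * (- (real n * v))"
    show ?case
    proof (rule Ck_on_SucI[of _ _ ?f'])
      show "(flat_exp n has_derivative ?f' t) (at t)" for t
        using flat_exp_deriv[of n t] unfolding has_field_derivative_def
        by (rule has_derivative_eq_rhs) (simp add: fun_eq_iff algebra_simps)
      show "Ck_on k UNIV (\<lambda>t. ?f' t v)" for v
        by (intro Ck_on_add Ck_on_linear_compose[OF *] Suc open_UNIV)
    qed simp
  qed
  then show ?thesis by (simp add: smooth_on_def)
qed

text \<open>The flat function of \<open>r^2 - |y - a|^2\<close>, normalised by its value at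
  \<open>a\<close>. The inner quadratic is critical at \<open>a\<close>, which gives derivative zero
  there whatever the outer derivative \<open>D\<close> is. The function is not constant near
  \<open>a\<close>; only its value and derivative at \<open>a\<close> are used.\<close>

lemma bump_function:
  fixes a :: "'b::euclidean_space"
  assumes "r > 0"
  obtains f :: "'b \<Rightarrow> real" where "smooth_on UNIV f" "f a = 1" "(f has_derivative (\<lambda>v. 0)) (at a)"
    "\<And>y. y \<notin> cball a r \<Longrightarrow> f y = 0"
proof -
  let ?q = "\<lambda>y. r\<^sup>2 + (- 1) * ((y - a) \<bullet> (y - a))"
  let ?k = "flat_exp 0 (r\<^sup>2)"
  have k: "?k > 0" using assms by (simp add: flat_exp_def)
  have id: "smooth_on UNIV (\<lambda>y::'b. y - a)"
    using smooth_on_add[OF open_UNIV smooth_on_linear[OF bounded_linear_ident open_UNIV] smooth_on_const[of _ "- a"]]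
    by simp
  have sq: "smooth_on UNIV ?q"
    by (intro smooth_on_add smooth_on_const smooth_on_bilinear[OF bounded_bilinear_mult]
        smooth_on_bilinear[OF bounded_bilinear_inner] id open_UNIV)
  have sm: "smooth_on UNIV (\<lambda>y. inverse ?k * flat_exp 0 (?q y))"
    by (intro smooth_on_bilinear[OF bounded_bilinear_mult] smooth_on_const
        smooth_on_compose[OF sq smooth_on_flat_exp]) auto
  have qa: "(?q has_derivative (\<lambda>v. 0)) (at a)"
    by (auto intro!: derivative_eq_intros)
  obtain D where D: "(flat_exp 0 has_derivative (\<lambda>h. D * h)) (at (?q a))"
    using flat_exp_deriv[of 0 "?q a"] unfolding has_field_derivative_def by blast
  have "((\<lambda>y. inverse ?k * flat_exp 0 (?q y)) has_derivative (\<lambda>v. inverse ?k * (D * 0))) (at a)"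
    by (intro has_derivative_mult_right has_derivative_compose[OF qa D])
  moreover have "flat_exp 0 (?q y) = 0" if "y \<notin> cball a r" for y
  proof -
    have "r < norm (y - a)" using that by (simp add: dist_norm norm_minus_commute)
    then have "r\<^sup>2 \<le> (norm (y - a))\<^sup>2" using assms by (intro power_mono) auto
    then show ?thesis by (simp add: flat_exp_def dot_square_norm)
  qed
  ultimately show ?thesis
    using k by (intro that[OF sm]) auto
qed

section \<open>Charts and vector bundles\<close>

text \<open>\<open>Blinfun f\<close> can be evaluated as \<open>f\<close> once \<open>f\<close> is
  bounded; on a Euclidean space linearity guarantees this. Hence the linearity proofs before each
  evaluation of a \<open>Blinfun\<close> below.\<close>

lemma blinfun_apply_Blinfun_linear:
  fixes f :: "'b::euclidean_space \<Rightarrow> 'c::real_normed_vector"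
  shows "linear f \<Longrightarrow> blinfun_apply (Blinfun f) = f"
  by (simp add: bounded_linear_Blinfun_apply linear_conv_bounded_linear)

context
  fixes A :: "('m::{t2_space, second_countable_topology}, 'b::euclidean_space) chart set"
  assumes M: "smooth_manifold A"
begin

lemma chart_open: "c \<in> A \<Longrightarrow> open (fst c)"
  and chart_open_image: "c \<in> A \<Longrightarrow> open (snd c ` fst c)"
  and chart_homeo: "c \<in> A \<Longrightarrow> homeomorphism (fst c) (snd c ` fst c) (snd c) (chart_inv c)"
  using M by (auto simp: smooth_manifold_def)

lemma chart_inv_left: "c \<in> A \<Longrightarrow> x \<in> fst c \<Longrightarrow> chart_inv c (snd c x) = x"
  using chart_homeo[of c] by (simp add: homeomorphism_def)

lemma chart_at: "chart_at A x \<in> A" "x \<in> fst (chart_at A x)"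
proof -
  have "x \<in> (\<Union>c\<in>A. fst c)" using M by (simp add: smooth_manifold_def)
  then have "\<exists>c. c \<in> A \<and> x \<in> fst c" by blast
  then have "chart_at A x \<in> A \<and> x \<in> fst (chart_at A x)" unfolding chart_at_def by (rule someI_ex)
  then show "chart_at A x \<in> A" "x \<in> fst (chart_at A x)" by auto
qed

lemma chart_open_image_Int:
  assumes "c \<in> A" "open W"
  shows "open (snd c ` (fst c \<inter> W))"
proof -
  have "continuous_on (snd c ` fst c) (chart_inv c)"
    using chart_homeo[OF assms(1)] by (simp add: homeomorphism_def)
  then have "open (snd c ` fst c \<inter> chart_inv c -` W)"
    by (rule continuous_open_preimage[OF _ chart_open_image[OF assms(1)] assms(2)])
  moreover have "snd c ` (fst c \<inter> W) = snd c ` fst c \<inter> chart_inv c -` W"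
    using chart_inv_left[OF assms(1)] by auto
  ultimately show ?thesis by simp
qed

lemma smooth_funI:
  "(\<And>c. c \<in> A \<Longrightarrow> smooth_on (snd c ` (fst c \<inter> W)) (\<lambda>y. g (chart_inv c y))) \<Longrightarrow> smooth_fun A W g"
  by (simp add: smooth_fun_def o_def)

lemma smooth_funD:
  "smooth_fun A W g \<Longrightarrow> c \<in> A \<Longrightarrow> smooth_on (snd c ` (fst c \<inter> W)) (\<lambda>y. g (chart_inv c y))"
  by (simp add: smooth_fun_def o_def)

lemma smooth_fun_subset:
  assumes "smooth_fun A V g" "W \<subseteq> V"
  shows "smooth_fun A W g"
  by (rule smooth_funI, rule smooth_on_subset[OF smooth_funD[OF assms(1)]]) (use assms(2) in auto)

lemma smooth_fun_cong:
  assumes "smooth_fun A W f" "open W" "\<And>x. x \<in> W \<Longrightarrow> f x = g x"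
  shows "smooth_fun A W g"
proof (rule smooth_funI)
  fix c assume c: "c \<in> A"
  show "smooth_on (snd c ` (fst c \<inter> W)) (\<lambda>y. g (chart_inv c y))"
    by (rule smooth_on_cong[OF smooth_funD[OF assms(1) c] chart_open_image_Int[OF c assms(2)]])
      (use assms(3) chart_inv_left[OF c] in auto)
qed

lemma smooth_fun_local:
  assumes "\<And>x. x \<in> W \<Longrightarrow> \<exists>V. open V \<and> x \<in> V \<and> smooth_fun A V g"
  shows "smooth_fun A W g"
proof (rule smooth_funI)
  fix c assume c: "c \<in> A"
  show "smooth_on (snd c ` (fst c \<inter> W)) (\<lambda>y. g (chart_inv c y))"
  proof (rule smooth_on_local)
    fix y assume "y \<in> snd c ` (fst c \<inter> W)"
    then obtain x where x: "x \<in> fst c" "x \<in> W" "y = snd c x" by auto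
    then obtain V where V: "open V" "x \<in> V" "smooth_fun A V g" using assms by blast
    show "\<exists>T. open T \<and> y \<in> T \<and> smooth_on T (\<lambda>y. g (chart_inv c y))"
      using x V chart_open_image_Int[OF c V(1)] smooth_funD[OF V(3) c]
      by (intro exI[of _ "snd c ` (fst c \<inter> V)"]) simp
  qed
qed

lemma smooth_fun_linear_family:
  fixes h :: "'m \<Rightarrow> 'f::real_normed_vector \<Rightarrow> 'g::real_normed_vector"
  assumes fin: "\<exists>B. finite B \<and> span B = (UNIV :: 'f set)" and W: "open W"
    and lin: "\<And>x. x \<in> W \<Longrightarrow> linear (h x)"
    and h: "\<And>w. smooth_fun A W (\<lambda>x. h x w)" and g: "smooth_fun A W g"
  shows "smooth_fun A W (\<lambda>x. h x (g x))"
proof (rule smooth_funI)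
  fix c assume c: "c \<in> A"
  show "smooth_on (snd c ` (fst c \<inter> W)) (\<lambda>y. h (chart_inv c y) (g (chart_inv c y)))"
    by (rule smooth_on_linear_family[OF fin chart_open_image_Int[OF c W] _ smooth_funD[OF h c] smooth_funD[OF g c]])
      (use lin chart_inv_left[OF c] in auto)
qed

lemma smooth_fun_bilinear:
  assumes "bounded_bilinear h" "open W" "smooth_fun A W f" "smooth_fun A W g"
  shows "smooth_fun A W (\<lambda>x. h (f x) (g x))"
  by (rule smooth_funI, rule smooth_on_bilinear[OF assms(1) chart_open_image_Int[OF _ assms(2)]
        smooth_funD[OF assms(3)] smooth_funD[OF assms(4)]])

lemma smooth_fun_linear_compose:
  assumes "bounded_linear h" "open W" "smooth_fun A W f"
  shows "smooth_fun A W (\<lambda>x. h (f x))"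
  by (rule smooth_funI, rule smooth_on_linear_compose[OF assms(1) chart_open_image_Int[OF _ assms(2)]
        smooth_funD[OF assms(3)]])

lemma smooth_fun_add:
  assumes "open W" "smooth_fun A W f" "smooth_fun A W g"
  shows "smooth_fun A W (\<lambda>x. f x + g x)"
  by (rule smooth_funI, rule smooth_on_add[OF chart_open_image_Int[OF _ assms(1)]
        smooth_funD[OF assms(2)] smooth_funD[OF assms(3)]])

lemma smooth_fun_const: "smooth_fun A W (\<lambda>x. c)"
  by (rule smooth_funI, rule smooth_on_const)

lemma smooth_fun_blinfun_real:
  fixes f :: "'m \<Rightarrow> 'c::euclidean_space \<Rightarrow>\<^sub>L real"
  assumes "open W" "\<And>v. smooth_fun A W (\<lambda>x. f x v)"
  shows "smooth_fun A W f"
  by (rule smooth_funI, rule smooth_on_blinfun_real[OF chart_open_image_Int[OF _ assms(1)]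
        smooth_funD[OF assms(2)]])

section \<open>Transition maps and their derivatives\<close>

lemma smooth_on_transition:
  "c \<in> A \<Longrightarrow> c' \<in> A \<Longrightarrow> smooth_on (snd c ` (fst c \<inter> fst c')) (snd c' \<circ> chart_inv c)"
  using M by (simp add: smooth_manifold_def)

lemma smooth_fun_chart:
  "c \<in> A \<Longrightarrow> smooth_fun A (fst c) (snd c)"
  using smooth_on_transition by (simp add: smooth_fun_def)

lemma smooth_fun_compose:
  fixes f :: "'m \<Rightarrow> 'c::euclidean_space"
  assumes "smooth_on T \<phi>" "open T" "open W" "smooth_fun A W f" "f ` W \<subseteq> T"
  shows "smooth_fun A W (\<lambda>x. \<phi> (f x))"
proof (rule smooth_funI)
  fix c assume c: "c \<in> A"
  show "smooth_on (snd c ` (fst c \<inter> W)) (\<lambda>y. \<phi> (f (chart_inv c y)))"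
    by (rule smooth_on_compose[OF smooth_funD[OF assms(4) c] assms(1) chart_open_image_Int[OF c assms(3)] assms(2)])
      (use assms(5) chart_inv_left[OF c] in auto)
qed

lemma has_derivative_coord_change:
  assumes "c \<in> A" "c' \<in> A" "x \<in> fst c" "x \<in> fst c'"
  shows "((snd c' \<circ> chart_inv c) has_derivative coord_change c c' x) (at (snd c x))"
proof -
  have D: "(snd c' \<circ> chart_inv c) differentiable (at (snd c x))"
    using assms by (intro smooth_on_differentiable[OF smooth_on_transition]) auto
  show ?thesis
    unfolding coord_change_def
    using has_derivative_frechet[OF D]
      bounded_linear_Blinfun_apply[OF has_derivative_bounded_linear[OF has_derivative_frechet[OF D]]]
    by simp
qed

lemma coord_change_eq:
  assumes "c \<in> A" "c' \<in> A" "x \<in> fst c" "x \<in> fst c'"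
  shows "coord_change c c' x v = frechet_derivative (snd c' \<circ> chart_inv c) (at (snd c x)) v"
  using frechet_derivativeI[OF has_derivative_coord_change[OF assms]] by simp

text \<open>Chain rule for transition maps. The composite through \<open>c'\<close> equals the
  direct transition only on the image of the overlap of \<open>c\<close> and \<open>c'\<close>,
  which is an open neighbourhood of the point.\<close>

lemma coord_change_cocycle:
  assumes "c \<in> A" "c' \<in> A" "c'' \<in> A" "x \<in> fst c" "x \<in> fst c'" "x \<in> fst c''"
  shows "coord_change c' c'' x (coord_change c c' x v) = coord_change c c'' x v"
proof -
  let ?f = "\<lambda>y. (snd c'' \<circ> chart_inv c') ((snd c' \<circ> chart_inv c) y)"
  have y: "(snd c' \<circ> chart_inv c) (snd c x) = snd c' x"
    using assms by (simp add: chart_inv_left)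
  have "(?f has_derivative (\<lambda>v. coord_change c' c'' x (coord_change c c' x v))) (at (snd c x))"
    by (rule has_derivative_compose[OF has_derivative_coord_change, of c c' x "snd c'' \<circ> chart_inv c'"])
      (use assms y has_derivative_coord_change[of c' c'' x] in auto)
  then have "((snd c'' \<circ> chart_inv c) has_derivative
      (\<lambda>v. coord_change c' c'' x (coord_change c c' x v))) (at (snd c x))"
    by (rule has_derivative_transform_within_open[OF _ chart_open_image_Int[OF assms(1) chart_open[OF assms(2)]]])
      (use assms in \<open>auto simp: chart_inv_left\<close>)
  then show ?thesis
    by (metis assms has_derivative_coord_change has_derivative_unique)
qed

lemma coord_change_self:
  assumes "c \<in> A" "x \<in> fst c"
  shows "coord_change c c x v = v"
proof -
  have "((snd c \<circ> chart_inv c) has_derivative (\<lambda>v. v)) (at (snd c x))"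
    by (rule has_derivative_transform_within_open[OF has_derivative_ident chart_open_image[OF assms(1)]])
      (use assms in \<open>auto simp: chart_inv_left\<close>)
  then show ?thesis
    by (metis assms has_derivative_coord_change has_derivative_unique)
qed

lemma coord_change_inverse:
  assumes "c \<in> A" "c' \<in> A" "x \<in> fst c" "x \<in> fst c'"
  shows "coord_change c' c x (coord_change c c' x v) = v"
  using assms by (simp add: coord_change_cocycle coord_change_self)

lemma smooth_fun_coord_change:
  assumes "c \<in> A" "c' \<in> A"
  shows "smooth_fun A (fst c \<inter> fst c') (\<lambda>x. coord_change c c' x v)"
proof -
  let ?D = "\<lambda>y. frechet_derivative (snd c' \<circ> chart_inv c) (at y) v"
  have o: "open (fst c \<inter> fst c')" using assms by (simp add: chart_open open_Int)
  have "smooth_fun A (fst c \<inter> fst c') (\<lambda>x. ?D (snd c x))"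
    by (rule smooth_fun_compose[OF smooth_on_derivative[OF smooth_on_transition[OF assms]]])
      (use assms o smooth_fun_subset[OF smooth_fun_chart] in
        \<open>auto intro!: chart_open_image_Int chart_open\<close>)
  then show ?thesis
    by (rule smooth_fun_cong) (use assms o in \<open>auto simp: coord_change_eq\<close>)
qed

end

section \<open>Fibrewise linear maps and local trivialisations\<close>

lemma linear_betweenD:
  assumes "linear_between V W h"
  shows "u \<in> V \<Longrightarrow> h u \<in> W" "u \<in> V \<Longrightarrow> v \<in> V \<Longrightarrow> h (u + v) = h u + h v"
    "u \<in> V \<Longrightarrow> h (r *\<^sub>R u) = r *\<^sub>R h u"
  using assms by (auto simp: linear_between_def)

lemma linear_between_zero: "linear_between V W h \<Longrightarrow> 0 \<in> V \<Longrightarrow> h 0 = 0"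
  using linear_betweenD(3)[of V W h 0 0] by simp

lemma linear_between_minus: "linear_between V W h \<Longrightarrow> u \<in> V \<Longrightarrow> h (- u) = - h u"
  using linear_betweenD(3)[of V W h u "-1"] by simp

lemma linear_between_diff:
  "linear_between V W h \<Longrightarrow> subspace V \<Longrightarrow> u \<in> V \<Longrightarrow> v \<in> V \<Longrightarrow> h (u - v) = h u - h v"
  using linear_betweenD(2)[of V W h u "- v"] linear_between_minus[of V W h v] by (simp add: subspace_neg)

lemma vector_bundle_fiber: "vector_bundle A E \<Longrightarrow> subspace (fiber E x)"
  and vector_bundle_finite:
    "vector_bundle A (E :: ('m::topological_space, 'e::real_vector, 'f::real_normed_vector) vbundle)
      \<Longrightarrow> \<exists>B. finite B \<and> span B = (UNIV :: 'f set)"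
  and vector_bundle_open: "vector_bundle A E \<Longrightarrow> (U, t) \<in> trivs E \<Longrightarrow> open U"
  and vector_bundle_linear:
    "vector_bundle A E \<Longrightarrow> (U, t) \<in> trivs E \<Longrightarrow> x \<in> U \<Longrightarrow> linear_between (fiber E x) UNIV (t x)"
  and vector_bundle_bij:
    "vector_bundle A E \<Longrightarrow> (U, t) \<in> trivs E \<Longrightarrow> x \<in> U \<Longrightarrow> bij_betw (t x) (fiber E x) UNIV"
  by (auto simp: vector_bundle_def)

lemma vector_bundle_triv_at:
  assumes "vector_bundle A E"
  obtains U t where "(U, t) \<in> trivs E" "x \<in> U" "open U"
proof -
  have "x \<in> (\<Union>(U, t)\<in>trivs E. U)" using assms by (simp add: vector_bundle_def)
  then obtain U t where "(U, t) \<in> trivs E" "x \<in> U" by auto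
  then show ?thesis using that vector_bundle_open[OF assms] by blast
qed

definition triv_inv :: "('m, 'e, 'f) vbundle \<Rightarrow> ('m \<Rightarrow> 'e \<Rightarrow> 'f) \<Rightarrow> 'm \<Rightarrow> 'f \<Rightarrow> 'e" where
  "triv_inv E t x = inv_into (fiber E x) (t x)"

lemma triv_inv:
  assumes "vector_bundle A E" "(U, t) \<in> trivs E" "x \<in> U"
  shows "triv_inv E t x w \<in> fiber E x" "t x (triv_inv E t x w) = w"
    "e \<in> fiber E x \<Longrightarrow> triv_inv E t x (t x e) = e"
  using vector_bundle_bij[OF assms]
  by (auto simp: triv_inv_def bij_betw_def inv_into_into f_inv_into_f)

lemma triv_inv_linear:
  assumes E: "vector_bundle A E" "(U, t) \<in> trivs E" "x \<in> U"
  shows "linear_between UNIV (fiber E x) (triv_inv E t x)"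
proof -
  note t = linear_betweenD[OF vector_bundle_linear[OF E]] and inv = triv_inv[OF E]
  have "triv_inv E t x (u + v) = triv_inv E t x u + triv_inv E t x v" for u v
    using inv(3)[of "triv_inv E t x u + triv_inv E t x v"] vector_bundle_fiber[OF E(1), of x]
    by (simp add: t inv subspace_add)
  moreover have "triv_inv E t x (r *\<^sub>R u) = r *\<^sub>R triv_inv E t x u" for r u
    using inv(3)[of "r *\<^sub>R triv_inv E t x u"] vector_bundle_fiber[OF E(1), of x]
    by (simp add: t inv subspace_scale)
  ultimately show ?thesis using inv(1) by (auto simp: linear_between_def)
qed

lemma linear_between_compose:
  "linear_between U V g \<Longrightarrow> linear_between V W h \<Longrightarrow> linear_between U W (\<lambda>u. h (g u))"
  by (auto simp: linear_between_def image_subset_iff)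

lemma linear_between_UNIV: "linear_between UNIV UNIV h \<longleftrightarrow> linear h"
  by (auto simp: linear_between_def linear_iff)

lemma bundle_mapD:
  assumes "bundle_map A E F h"
  shows "linear_between (fiber E x) (fiber F x) (h x)"
    "(U, t) \<in> trivs E \<Longrightarrow> (V, s) \<in> trivs F \<Longrightarrow> smooth_fun A (U \<inter> V) (\<lambda>x. s x (h x (triv_inv E t x w)))"
proof -
  show "linear_between (fiber E x) (fiber F x) (h x)" using assms by (simp add: bundle_map_def)
  show "smooth_fun A (U \<inter> V) (\<lambda>x. s x (h x (triv_inv E t x w)))"
    if "(U, t) \<in> trivs E" "(V, s) \<in> trivs F"
    using bspec[OF bspec[OF conjunct2[OF assms[unfolded bundle_map_def]] that(1), unfolded prod.case] that(2)]
    by (simp add: triv_inv_def)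
qed

lemma smooth_sectionD:
  assumes "smooth_section A E \<sigma>"
  shows "\<sigma> x \<in> fiber E x" "(U, t) \<in> trivs E \<Longrightarrow> smooth_fun A U (\<lambda>x. t x (\<sigma> x))"
  using assms by (auto simp: smooth_section_def)

context
  fixes A :: "('m::{t2_space, second_countable_topology}, 'b::euclidean_space) chart set"
  assumes M: "smooth_manifold A"
begin

text \<open>In trivialisations \<open>h\<close> is a smooth family of linear maps, applied here to
  the smooth coordinates \<open>t x (e x)\<close>.\<close>

lemma smooth_fun_bundle_map:
  assumes E: "vector_bundle A E" "(U, t) \<in> trivs E"
    and F: "vector_bundle A F" "(V, s) \<in> trivs F"
    and h: "bundle_map A E F h"
    and W: "open W" "W \<subseteq> U \<inter> V"
    and e: "\<And>x. x \<in> W \<Longrightarrow> e x \<in> fiber E x" "smooth_fun A W (\<lambda>x. t x (e x))"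
  shows "smooth_fun A W (\<lambda>x. s x (h x (e x)))"
proof -
  have "smooth_fun A W (\<lambda>x. s x (h x (triv_inv E t x (t x (e x)))))"
  proof (rule smooth_fun_linear_family[OF M vector_bundle_finite[OF E(1)] W(1) _ _ e(2)])
    fix x assume "x \<in> W"
    then show "linear (\<lambda>w. s x (h x (triv_inv E t x w)))"
      using W(2) unfolding linear_between_UNIV[symmetric]
      by (intro linear_between_compose[OF linear_between_compose[OF triv_inv_linear[OF E] bundle_mapD(1)[OF h]]
            vector_bundle_linear[OF F]]) auto
  next
    show "smooth_fun A W (\<lambda>x. s x (h x (triv_inv E t x w)))" for w
      by (rule smooth_fun_subset[OF M bundle_mapD(2)[OF h E(2) F(2)] W(2)])
  qed
  then show ?thesis
    by (rule smooth_fun_cong[OF M _ W(1)]) (use W(2) triv_inv(3)[OF E] e(1) in auto)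
qed

lemma smooth_section_bundle_map:
  assumes E: "vector_bundle A E" and F: "vector_bundle A F"
    and h: "bundle_map A E F h" and \<sigma>: "smooth_section A E \<sigma>"
  shows "smooth_section A F (\<lambda>x. h x (\<sigma> x))"
  unfolding smooth_section_def
proof (intro conjI allI ballI, goal_cases)
  case (1 x)
  show ?case by (rule linear_betweenD(1)[OF bundle_mapD(1)[OF h] smooth_sectionD(1)[OF \<sigma>]])
next
  case (2 p)
  obtain V s where p: "p = (V, s)" by (cases p)
  with 2 have V: "(V, s) \<in> trivs F" by simp
  have "smooth_fun A V (\<lambda>x. s x (h x (\<sigma> x)))"
  proof (rule smooth_fun_local[OF M])
    fix x assume x: "x \<in> V"
    obtain U t where U: "(U, t) \<in> trivs E" "x \<in> U" "open U" by (rule vector_bundle_triv_at[OF E])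
    have o: "open (U \<inter> V)" using U(3) vector_bundle_open[OF F V] by blast
    have "smooth_fun A (U \<inter> V) (\<lambda>x. s x (h x (\<sigma> x)))"
      by (rule smooth_fun_bundle_map[OF E U(1) F V h o])
        (use smooth_sectionD(1)[OF \<sigma>]
          smooth_fun_subset[OF M smooth_sectionD(2)[OF \<sigma> U(1)] Int_lower1] in auto)
    then show "\<exists>W. open W \<and> x \<in> W \<and> smooth_fun A W (\<lambda>x. s x (h x (\<sigma> x)))"
      using o U x by blast
  qed
  then show ?case by (simp add: p)
qed

text \<open>The test of the composite uses trivialisations of \<open>E\<close> and \<open>G\<close>
  only; near each point a trivialisation of \<open>F\<close> is interposed, in which the
  intermediate vector has smooth coordinates.\<close>

lemma bundle_map_compose:
  assumes E: "vector_bundle A E" and F: "vector_bundle A F" and G: "vector_bundle A G"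
    and h: "bundle_map A E F h" and k: "bundle_map A F G k"
  shows "bundle_map A E G (\<lambda>x e. k x (h x e))"
  unfolding bundle_map_def triv_inv_def[symmetric]
proof (intro conjI allI ballI, goal_cases)
  case (1 x)
  show ?case by (rule linear_between_compose[OF bundle_mapD(1)[OF h] bundle_mapD(1)[OF k]])
next
  case (2 p)
  obtain U t where p: "p = (U, t)" by (cases p)
  with 2 have U: "(U, t) \<in> trivs E" by simp
  have "smooth_fun A (U \<inter> V) (\<lambda>x. s x (k x (h x (triv_inv E t x w))))"
    if V: "(V, s) \<in> trivs G" for V s w
  proof (rule smooth_fun_local[OF M])
    fix x assume x: "x \<in> U \<inter> V"
    obtain W q where W: "(W, q) \<in> trivs F" "x \<in> W" "open W" by (rule vector_bundle_triv_at[OF F])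
    have o: "open (U \<inter> V \<inter> W)"
      using W(3) vector_bundle_open[OF E U] vector_bundle_open[OF G V] by blast
    have "smooth_fun A (U \<inter> V \<inter> W) (\<lambda>x. q x (h x (triv_inv E t x w)))"
      by (rule smooth_fun_subset[OF M bundle_mapD(2)[OF h U W(1)]]) auto
    then have "smooth_fun A (U \<inter> V \<inter> W) (\<lambda>x. s x (k x (h x (triv_inv E t x w))))"
      by (intro smooth_fun_bundle_map[OF F W(1) G V k o])
        (auto intro: linear_betweenD(1)[OF bundle_mapD(1)[OF h]] triv_inv(1)[OF E U])
    then show "\<exists>V'. open V' \<and> x \<in> V' \<and> smooth_fun A V' (\<lambda>x. s x (k x (h x (triv_inv E t x w))))"
      using o W x by blast
  qed
  then show ?case by (auto simp: p)
qed

lemma smooth_section_zero: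
  assumes E: "vector_bundle A E"
  shows "smooth_section A E (\<lambda>x. 0)"
proof -
  have "smooth_fun A U (\<lambda>x. t x 0)" if U: "(U, t) \<in> trivs E" for U t
    by (rule smooth_fun_cong[OF M smooth_fun_const[OF M, of U 0] vector_bundle_open[OF E U]])
      (use linear_between_zero[OF vector_bundle_linear[OF E U]] vector_bundle_fiber[OF E] subspace_0 in force)
  then show ?thesis using vector_bundle_fiber[OF E] by (auto simp: smooth_section_def subspace_0)
qed

lemma smooth_section_diff:
  assumes E: "vector_bundle A E" and s: "smooth_section A E \<sigma>" and t: "smooth_section A E \<tau>"
  shows "smooth_section A E (\<lambda>x. \<sigma> x - \<tau> x)"
proof -
  note \<sigma> = smooth_sectionD[OF s] and \<tau> = smooth_sectionD[OF t]
  have "smooth_fun A U (\<lambda>x. t x (\<sigma> x - \<tau> x))" if U: "(U, t) \<in> trivs E" for U t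
  proof -
    note o = vector_bundle_open[OF E U]
    have "smooth_fun A U (\<lambda>x. t x (\<sigma> x) + (-1) *\<^sub>R t x (\<tau> x))"
      using o U
      by (intro smooth_fun_add[OF M] smooth_fun_bilinear[OF M bounded_bilinear_scaleR]
          smooth_fun_const[OF M] \<sigma> \<tau>)
    then show ?thesis
      by (rule smooth_fun_cong[OF M _ o])
        (simp add: linear_between_diff[OF vector_bundle_linear[OF E U] vector_bundle_fiber[OF E]] \<sigma> \<tau>)
  qed
  then show ?thesis
    using vector_bundle_fiber[OF E] by (auto simp: smooth_section_def subspace_diff \<sigma> \<tau>)
qed

text \<open>The argument for linear families is used twice, once per slot. Symmetry exchanges the
  slots in between, as the linearity at hand concerns the second one.\<close>

lemma smooth_fun_inner_product:
  assumes E: "vector_bundle A E" "(U, t) \<in> trivs E"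
    and ip: "bundle_inner_product A E ip"
    and W: "open W" "W \<subseteq> U"
    and d: "\<And>x. x \<in> W \<Longrightarrow> d x \<in> fiber E x" "smooth_fun A W (\<lambda>x. t x (d x))"
    and e: "\<And>x. x \<in> W \<Longrightarrow> e x \<in> fiber E x" "smooth_fun A W (\<lambda>x. t x (e x))"
  shows "smooth_fun A W (\<lambda>x. ip x (d x) (e x))"
proof -
  have lin: "linear_between (fiber E x) UNIV (ip x u)" if "u \<in> fiber E x" for x u
    using ip that by (simp add: bundle_inner_product_def)
  have sym: "ip x u v = ip x v u" if "u \<in> fiber E x" "v \<in> fiber E x" for x u v
    using ip that by (simp add: bundle_inner_product_def)
  have sm: "smooth_fun A U (\<lambda>x. ip x (triv_inv E t x w) (triv_inv E t x w'))" for w w'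
    using ip E(2) by (auto simp: bundle_inner_product_def triv_inv_def)
  note fin = vector_bundle_finite[OF E(1)] and inv = triv_inv[OF E] and inv_lin = triv_inv_linear[OF E]
  have lin': "linear (\<lambda>w. ip x u (triv_inv E t x w))" if "x \<in> W" "u \<in> fiber E x" for x u
    unfolding linear_between_UNIV[symmetric]
    using that W(2) by (intro linear_between_compose[OF inv_lin lin]) auto
  have 1: "smooth_fun A W (\<lambda>x. ip x (triv_inv E t x w) (e x))" for w
  proof -
    have "smooth_fun A W (\<lambda>x. ip x (triv_inv E t x w) (triv_inv E t x (t x (e x))))"
      by (rule smooth_fun_linear_family[OF M fin W(1) lin' smooth_fun_subset[OF M sm W(2)] e(2)])
        (use inv(1) W(2) in auto)
    then show ?thesis
      by (rule smooth_fun_cong[OF M _ W(1)]) (use W(2) inv(3) e(1) in auto)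
  qed
  have 2: "smooth_fun A W (\<lambda>x. ip x (e x) (triv_inv E t x w))" for w
    by (rule smooth_fun_cong[OF M 1 W(1)]) (use W(2) inv(1) e(1) sym in auto)
  have "smooth_fun A W (\<lambda>x. ip x (e x) (triv_inv E t x (t x (d x))))"
    by (rule smooth_fun_linear_family[OF M fin W(1) lin' 2 d(2)]) (use e(1) in auto)
  then show ?thesis
    by (rule smooth_fun_cong[OF M _ W(1)]) (use W(2) inv(3) e(1) d(1) sym in auto)
qed

end

section \<open>Tangent and cotangent bundle\<close>

text \<open>Common core of the tangent and cotangent bundle. The explicit inverse \<open>u\<close>
  of a trivialisation replaces \<open>inv_into\<close>, both in the smoothness test and in later
  computations.\<close>

lemma vector_bundle_chartwise:
  fixes A :: "('m::{t2_space, second_countable_topology}, 'b::euclidean_space) chart set"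
    and E :: "('m, 'e::real_vector, 'f::real_normed_vector) vbundle"
  assumes M: "smooth_manifold A"
    and fin: "\<exists>B. finite B \<and> span B = (UNIV :: 'f set)"
    and fib: "\<And>x. fiber E x = UNIV"
    and triv: "trivs E = (\<lambda>c. (fst c, t c)) ` A"
    and lin: "\<And>c x. c \<in> A \<Longrightarrow> x \<in> fst c \<Longrightarrow> linear (t c x)"
    and tu: "\<And>c x w. c \<in> A \<Longrightarrow> x \<in> fst c \<Longrightarrow> t c x (u c x w) = w"
    and ut: "\<And>c x e. c \<in> A \<Longrightarrow> x \<in> fst c \<Longrightarrow> u c x (t c x e) = e"
    and sm: "\<And>c c' w. c \<in> A \<Longrightarrow> c' \<in> A \<Longrightarrow> smooth_fun A (fst c \<inter> fst c') (\<lambda>x. t c' x (u c x w))"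
  shows "vector_bundle A E"
    and "c \<in> A \<Longrightarrow> x \<in> fst c \<Longrightarrow> triv_inv E (t c) x w = u c x w"
proof -
  show inv: "triv_inv E (t c) x w = u c x w" if "c \<in> A" "x \<in> fst c" for c x w
    unfolding triv_inv_def fib
    using inj_on_inverseI[of UNIV "u c x" "t c x"] ut[OF that] tu[OF that] by (intro inv_into_f_eq) simp_all
  have bij: "bij_betw (t c x) UNIV UNIV" if "c \<in> A" "x \<in> fst c" for c x
    by (rule bij_betw_byWitness[where f' = "u c x"]) (use that tu ut in auto)
  have sm': "smooth_fun A (fst c \<inter> fst c') (\<lambda>x. t c' x (triv_inv E (t c) x w))"
    if "c \<in> A" "c' \<in> A" for c c' w
    by (rule smooth_fun_cong[OF M sm[OF that]])
      (use that inv chart_open[OF M] in \<open>simp_all add: open_Int\<close>)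
  show "vector_bundle A E"
    unfolding vector_bundle_def fib triv
  proof (intro conjI)
    have "x \<in> (\<Union>c\<in>A. fst c)" for x using chart_at[OF M, of x] by blast
    then show "(\<Union>(U, t)\<in>(\<lambda>c. (fst c, t c)) ` A. U) = UNIV" by auto
  qed (use fin bij sm'[unfolded triv_inv_def fib] chart_open[OF M] lin in \<open>simp_all add: linear_between_UNIV\<close>)
qed

definition tangent_triv where
  "tangent_triv A c x v = blinfun_apply (coord_change (chart_at A x) c x) v"

definition cotangent_triv where
  "cotangent_triv A c x \<alpha> = \<alpha> o\<^sub>L coord_change c (chart_at A x) x"

text \<open>In the chart \<open>c\<close> its components are
  \<open>\<phi> y *\<^sub>R \<alpha>\<close> with constant \<open>\<alpha>\<close>. The pullback by
  \<open>coord_change\<close> appears because a covector at \<open>x\<close> is represented in the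
  chart chosen at \<open>x\<close>. Outside the chart it is extended by zero.\<close>

definition local_form ::
    "('m, 'b::euclidean_space) chart set \<Rightarrow> ('m, 'b) chart \<Rightarrow> ('b \<Rightarrow> real) \<Rightarrow> ('b \<Rightarrow>\<^sub>L real) \<Rightarrow>
     'm \<Rightarrow> 'b \<Rightarrow>\<^sub>L real" where
  "local_form A c \<phi> \<alpha> x =
     (if x \<in> fst c then \<phi> (snd c x) *\<^sub>R (\<alpha> o\<^sub>L coord_change (chart_at A x) c x) else 0)"

lemma fiber_tangent_bundle [simp]: "fiber (tangent_bundle A) x = UNIV"
  and trivs_tangent_bundle: "trivs (tangent_bundle A) = (\<lambda>c. (fst c, tangent_triv A c)) ` A"
  and fiber_cotangent_bundle [simp]: "fiber (cotangent_bundle A) x = UNIV"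
  and trivs_cotangent_bundle: "trivs (cotangent_bundle A) = (\<lambda>c. (fst c, cotangent_triv A c)) ` A"
  by (simp_all add: tangent_bundle_def cotangent_bundle_def tangent_triv_def[abs_def]
      cotangent_triv_def[abs_def])

context
  fixes A :: "('m::{t2_space, second_countable_topology}, 'b::euclidean_space) chart set"
  assumes M: "smooth_manifold A"
begin

lemma tangent_bundle:
  shows "vector_bundle A (tangent_bundle A)"
    and "c \<in> A \<Longrightarrow> x \<in> fst c \<Longrightarrow>
      triv_inv (tangent_bundle A) (tangent_triv A c) x w = coord_change c (chart_at A x) x w"
proof -
  have sm: "smooth_fun A (fst c \<inter> fst c')
      (\<lambda>x. tangent_triv A c' x (coord_change c (chart_at A x) x w))" if "c \<in> A" "c' \<in> A" for c c' w
    by (rule smooth_fun_cong[OF M smooth_fun_coord_change[OF M that]])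
      (use that chart_open[OF M] chart_at[OF M] in
        \<open>simp_all add: open_Int tangent_triv_def coord_change_cocycle[OF M]\<close>)
  have lin: "linear (tangent_triv A c x)" for c x
    unfolding tangent_triv_def[abs_def] by (rule bounded_linear.linear[OF blinfun.bounded_linear_right])
  have tu: "tangent_triv A c x (coord_change c (chart_at A x) x w) = w" if "c \<in> A" "x \<in> fst c" for c x w
    unfolding tangent_triv_def using that chart_at[OF M] by (intro coord_change_inverse[OF M])
  have ut: "coord_change c (chart_at A x) x (tangent_triv A c x e) = e" if "c \<in> A" "x \<in> fst c" for c x e
    unfolding tangent_triv_def using that chart_at[OF M] by (intro coord_change_inverse[OF M])
  note * = vector_bundle_chartwise[where u = "\<lambda>c x. coord_change c (chart_at A x) x",
      OF M finite_dim_euclidean fiber_tangent_bundle trivs_tangent_bundle lin tu ut sm]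
  show "vector_bundle A (tangent_bundle A)" by (rule *(1))
  show "triv_inv (tangent_bundle A) (tangent_triv A c) x w = coord_change c (chart_at A x) x w"
    if "c \<in> A" "x \<in> fst c" by (rule *(2)) (use that in simp_all)
qed

lemma cotangent_bundle:
  shows "vector_bundle A (cotangent_bundle A)"
    and "c \<in> A \<Longrightarrow> x \<in> fst c \<Longrightarrow>
      triv_inv (cotangent_bundle A) (cotangent_triv A c) x \<omega> = \<omega> o\<^sub>L coord_change (chart_at A x) c x"
proof -
  have sm: "smooth_fun A (fst c \<inter> fst c')
      (\<lambda>x. cotangent_triv A c' x (\<omega> o\<^sub>L coord_change (chart_at A x) c x))"
    if "c \<in> A" "c' \<in> A" for c c' and \<omega> :: "'b \<Rightarrow>\<^sub>L real"
  proof (rule smooth_fun_blinfun_real[OF M])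
    show o: "open (fst c \<inter> fst c')" using that by (simp add: open_Int chart_open[OF M])
    have o': "open (fst c' \<inter> fst c)" using that by (simp add: open_Int chart_open[OF M])
    fix v
    \<comment> \<open>Covector components change by the transpose of the coordinate change in the
      opposite direction, from \<open>c'\<close> to \<open>c\<close>.\<close>
    have "smooth_fun A (fst c \<inter> fst c') (\<lambda>x. \<omega> (coord_change c' c x v))"
      using smooth_fun_linear_compose[OF M blinfun.bounded_linear_right[of \<omega>] o'
          smooth_fun_coord_change[OF M that(2,1)]] by (simp add: Int_commute)
    then show "smooth_fun A (fst c \<inter> fst c')
        (\<lambda>x. cotangent_triv A c' x (\<omega> o\<^sub>L coord_change (chart_at A x) c x) v)"
      by (rule smooth_fun_cong[OF M _ o])
        (use that chart_at[OF M] in \<open>simp_all add: cotangent_triv_def coord_change_cocycle[OF M]\<close>)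
  qed
  have lin: "linear (cotangent_triv A c x)" for c x
    unfolding cotangent_triv_def[abs_def]
    by (intro bounded_linear.linear bounded_bilinear.bounded_linear_left[OF bounded_bilinear_blinfun_compose])
  have tu: "cotangent_triv A c x (w o\<^sub>L coord_change (chart_at A x) c x) = w"
    if "c \<in> A" "x \<in> fst c" for c x w
    using coord_change_inverse[OF M that(1) chart_at(1)[OF M] that(2) chart_at(2)[OF M]]
    by (simp add: cotangent_triv_def blinfun_eqI)
  have ut: "cotangent_triv A c x e o\<^sub>L coord_change (chart_at A x) c x = e"
    if "c \<in> A" "x \<in> fst c" for c x e
    using coord_change_inverse[OF M chart_at(1)[OF M] that(1) chart_at(2)[OF M] that(2)]
    by (simp add: cotangent_triv_def blinfun_eqI)
  note * = vector_bundle_chartwise[where u = "\<lambda>c x w. w o\<^sub>L coord_change (chart_at A x) c x",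
      OF M finite_dim_dual fiber_cotangent_bundle trivs_cotangent_bundle lin tu ut sm]
  show "vector_bundle A (cotangent_bundle A)" by (rule *(1))
  show "triv_inv (cotangent_bundle A) (cotangent_triv A c) x \<omega> = \<omega> o\<^sub>L coord_change (chart_at A x) c x"
    if "c \<in> A" "x \<in> fst c" by (rule *(2)) (use that in simp_all)
qed

section \<open>Vector fields and one-forms in charts\<close>

lemma one_form_iff:
  "one_form A \<xi> \<longleftrightarrow> (\<forall>c\<in>A. smooth_fun A (fst c) (\<lambda>x. cotangent_triv A c x (\<xi> x)))"
  by (simp add: smooth_section_def trivs_cotangent_bundle)

lemma vector_field_iff:
  "vector_field A X \<longleftrightarrow> (\<forall>c\<in>A. smooth_fun A (fst c) (\<lambda>x. tangent_triv A c x (X x)))"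
  by (simp add: smooth_section_def trivs_tangent_bundle)

lemma smooth_on_form1_in:
  assumes "one_form A \<xi>" "c \<in> A"
  shows "smooth_on (snd c ` fst c) (form1_in A c \<xi>)"
  using assms smooth_funD[OF M, of "fst c" "\<lambda>x. cotangent_triv A c x (\<xi> x)" c]
  by (simp add: one_form_iff form1_in_def[abs_def] cotangent_triv_def Let_def)

lemma smooth_on_vf_in:
  assumes "vector_field A X" "c \<in> A"
  shows "smooth_on (snd c ` fst c) (vf_in A c X)"
  using assms smooth_funD[OF M, of "fst c" "\<lambda>x. tangent_triv A c x (X x)" c]
  by (simp add: vector_field_iff vf_in_def[abs_def] tangent_triv_def Let_def)

lemma form1_in_differentiable: "one_form A \<xi> \<Longrightarrow> form1_in A (chart_at A x) \<xi> differentiable at (snd (chart_at A x) x)"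
  using smooth_on_differentiable[OF smooth_on_form1_in] chart_at[OF M, of x] by blast

lemma vf_in_differentiable: "vector_field A X \<Longrightarrow> vf_in A (chart_at A x) X differentiable at (snd (chart_at A x) x)"
  using smooth_on_differentiable[OF smooth_on_vf_in] chart_at[OF M, of x] by blast

text \<open>The support lies in the preimage of \<open>K\<close>, which is compact and hence closed
  because the manifold is Hausdorff. A point outside the chart \<open>c\<close> therefore has a
  neighbourhood on which the form vanishes; inside the chart the form is a product of smooth
  factors.\<close>

lemma one_form_local_form:
  assumes c: "c \<in> A" and K: "compact K" "K \<subseteq> snd c ` fst c"
    and \<phi>: "smooth_on UNIV \<phi>" "\<And>y. y \<notin> K \<Longrightarrow> \<phi> y = 0"
  shows "one_form A (local_form A c \<phi> \<alpha>)"
  unfolding one_form_iff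
proof
  fix c' assume c': "c' \<in> A"
  let ?f = "\<lambda>x. cotangent_triv A c' x (local_form A c \<phi> \<alpha> x)"
  have "compact (chart_inv c ` K)"
    using K chart_homeo[OF M c] by (intro compact_continuous_image) (auto simp: homeomorphism_def intro: continuous_on_subset)
  then have cl: "closed (chart_inv c ` K)" by (rule compact_imp_closed)
  show "smooth_fun A (fst c') ?f"
  proof (rule smooth_fun_local[OF M])
    fix x assume x: "x \<in> fst c'"
    show "\<exists>V. open V \<and> x \<in> V \<and> smooth_fun A V ?f"
    proof (cases "x \<in> fst c")
      case True
      have o: "open (fst c \<inter> fst c')" using c c' by (simp add: open_Int chart_open[OF M])
      have 1: "smooth_fun A (fst c \<inter> fst c') (\<lambda>x. \<phi> (snd c x))"
        by (rule smooth_fun_compose[OF M \<phi>(1) open_UNIV o smooth_fun_subset[OF M smooth_fun_chart[OF M c]]]) auto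
      have "smooth_fun A (fst c \<inter> fst c')
          (\<lambda>x. cotangent_triv A c' x (triv_inv (cotangent_bundle A) (cotangent_triv A c) x \<alpha>))"
        using cotangent_bundle(1) c c'
        by (auto simp: vector_bundle_def trivs_cotangent_bundle triv_inv_def)
      then have "smooth_fun A (fst c \<inter> fst c')
          (\<lambda>x. cotangent_triv A c' x (\<alpha> o\<^sub>L coord_change (chart_at A x) c x))"
        by (rule smooth_fun_cong[OF M _ o]) (simp add: cotangent_bundle(2) c)
      from smooth_fun_bilinear[OF M bounded_bilinear_scaleR o 1 this]
      have "smooth_fun A (fst c \<inter> fst c') ?f"
        by (rule smooth_fun_cong[OF M _ o])
          (simp add: local_form_def cotangent_triv_def
            bounded_bilinear.scaleR_left[OF bounded_bilinear_blinfun_compose])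
      then show ?thesis using o x True by blast
    next
      case False
      let ?V = "fst c' - chart_inv c ` K"
      have o: "open ?V" using chart_open[OF M c'] cl by (rule open_Diff)
      have 0: "local_form A c \<phi> \<alpha> z = 0" if "z \<in> ?V" for z
        using that \<phi>(2)[of "snd c z"] chart_inv_left[OF M c] by (force simp: local_form_def)
      have "smooth_fun A ?V ?f"
        by (rule smooth_fun_cong[OF M smooth_fun_const[OF M, of _ 0] o])
          (simp add: 0 cotangent_triv_def)
      moreover have "x \<in> ?V" using x False K chart_inv_left[OF M c] by auto
      ultimately show ?thesis using o by blast
    qed
  qed
qed

end

section \<open>Poisson bivector fields\<close>

context
  fixes A :: "('m::{t2_space, second_countable_topology}, 'b::euclidean_space) chart set"
  assumes M: "smooth_manifold A"
begin

lemma lie_bracket_zero: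
  "vector_field A X \<Longrightarrow> lie_bracket A X (\<lambda>x. 0) x = 0"
  "vector_field A X \<Longrightarrow> lie_bracket A (\<lambda>x. 0) X x = 0"
  using linear_0[OF linear_frechet_derivative[OF vf_in_differentiable[OF M, of X x]]]
  by (simp_all add: lie_bracket_def Let_def vf_in_def[of A _ "\<lambda>x. 0", abs_def])

text \<open>Allows the \<open>Blinfun\<close> in the form part of the bracket to be
  evaluated.\<close>

lemma linear_lie_deriv1:
  assumes "vector_field A X"
  shows "linear (lie_deriv1 A X \<eta> x)"
proof -
  note D = linear_frechet_derivative[OF vf_in_differentiable[OF M assms]]
  show ?thesis
    unfolding lie_deriv1_def[abs_def] Let_def
    by (intro linear_compose_add bounded_linear.linear[OF blinfun.bounded_linear_right]
        linear_compose[OF D bounded_linear.linear[OF blinfun.bounded_linear_right], unfolded o_def])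
qed

lemma linear_ext_deriv1:
  assumes "one_form A \<xi>"
  shows "linear (ext_deriv1 A \<xi> x u)"
proof -
  note D = linear_frechet_derivative[OF form1_in_differentiable[OF M assms]]
  show ?thesis
    by (rule linearI) (simp_all add: ext_deriv1_def Let_def linear_add[OF D] linear_cmul[OF D]
        blinfun.bilinear_simps algebra_simps)
qed

lemma ext_deriv1_zero:
  assumes "one_form A \<xi>"
  shows "ext_deriv1 A \<xi> x 0 v = 0"
  using linear_0[OF linear_frechet_derivative[OF form1_in_differentiable[OF M assms]]]
  by (simp add: ext_deriv1_def Let_def blinfun.bilinear_simps)

lemma lie_deriv1_zero:
  assumes "one_form A \<eta>"
  shows "lie_deriv1 A (\<lambda>x. 0) \<eta> x v = 0"
  using linear_0[OF linear_frechet_derivative[OF form1_in_differentiable[OF M assms]]]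
  by (simp add: lie_deriv1_def Let_def blinfun.bilinear_simps vf_in_def[of A _ "\<lambda>x. 0", abs_def])

text \<open>Isolates the local calculus: \<open>E\<close>, its bracket and \<open>J\<close> have
  disappeared, and the identity for global one-forms is the only link to them.\<close>

lemma poisson_bivectorI:
  assumes bm: "bundle_map A (cotangent_bundle A) (tangent_bundle A) P"
    and star: "\<And>\<alpha> \<beta> x. one_form A \<alpha> \<Longrightarrow> one_form A \<beta> \<Longrightarrow>
      P x (Blinfun (\<lambda>v. lie_deriv1 A (\<lambda>x. P x (\<alpha> x)) \<beta> x v - ext_deriv1 A \<alpha> x (P x (\<beta> x)) v)) =
      lie_bracket A (\<lambda>x. P x (\<alpha> x)) (\<lambda>x. P x (\<beta> x)) x"
  shows "poisson_bivector A P"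
proof -
  have lin: "linear (P x)" for x
    using bundle_mapD(1)[OF bm] by (simp add: linear_between_UNIV)
  note lin_simps = linear_add[OF lin] linear_diff[OF lin] linear_cmul[OF lin]
  \<comment> \<open>The matrix of \<open>P\<close> in the chart \<open>c\<close>, sending covector
    components to vector components; \<open>DQ\<close> is its derivative at the point.\<close>
  define Q where "Q c y \<mu> = (let z = chart_inv c y; d = coord_change (chart_at A z) c z in
    d (P z (\<mu> o\<^sub>L d)))" for c y \<mu>
  have biv: "bivector_in A c P y \<mu> \<nu> = \<nu> (Q c y \<mu>)" for c y and \<mu> \<nu> :: "'b \<Rightarrow>\<^sub>L real"
    by (simp add: bivector_in_def Q_def Let_def)
  have smQ: "smooth_on (snd c ` fst c) (\<lambda>y. Q c y \<mu>)" if c: "c \<in> A" for c \<mu>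
  proof -
    have "smooth_fun A (fst c \<inter> fst c)
        (\<lambda>x. tangent_triv A c x (P x (triv_inv (cotangent_bundle A) (cotangent_triv A c) x \<mu>)))"
      by (rule bundle_mapD(2)[OF bm]) (use c in \<open>auto simp: trivs_tangent_bundle trivs_cotangent_bundle\<close>)
    from this[unfolded Int_absorb]
    have "smooth_fun A (fst c) (\<lambda>x. tangent_triv A c x (P x (\<mu> o\<^sub>L coord_change (chart_at A x) c x)))"
      by (rule smooth_fun_cong[OF M]) (simp_all add: cotangent_bundle(2)[OF M] c chart_open[OF M])
    from smooth_funD[OF M this c] show ?thesis
      by (simp add: Q_def Let_def tangent_triv_def)
  qed
  define DQ where "DQ x \<mu> = frechet_derivative (\<lambda>y. Q (chart_at A x) y \<mu>) (at (snd (chart_at A x) x))"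
    for x \<mu>
  have DQ: "((\<lambda>y. Q (chart_at A x) y \<mu>) has_derivative DQ x \<mu>) (at (snd (chart_at A x) x))" for x \<mu>
    unfolding DQ_def using chart_at[OF M, of x]
    by (intro has_derivative_frechet smooth_on_differentiable[OF smQ]) auto
  have linDQ: "linear (DQ x \<mu>)" for x \<mu>
    using DQ by (rule has_derivative_linear)
  have Q0: "Q (chart_at A x) (snd (chart_at A x) x) \<mu> = P x \<mu>" for x \<mu>
  proof -
    have "\<mu> o\<^sub>L coord_change (chart_at A x) (chart_at A x) x = \<mu>"
      using coord_change_self[OF M chart_at[OF M]] by (simp add: blinfun_eqI)
    then show ?thesis
      using chart_inv_left[OF M chart_at[OF M]] coord_change_self[OF M chart_at[OF M]]
      by (simp add: Q_def Let_def)
  qed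

  \<comment> \<open>The identity at \<open>x\<close> for \<open>\<alpha>\<close> and
    \<open>\<beta>\<close> with components \<open>\<phi> y *\<^sub>R \<mu>\<close> and
    \<open>\<psi> y *\<^sub>R \<nu>\<close>. Since \<open>\<psi>\<close> has derivative zero, the
    Lie derivative keeps only \<open>\<nu>\<close> applied to the derivative of P\<alpha>; the
    bracketed difference is d\<alpha> contracted with P\<beta>. The jet of \<open>\<phi>\<close>
    stays free: value 0 with derivative \<open>l\<close> will give skewness, value 1 with derivative
    0 the Jacobi identity.\<close>
  have key: "P x (Blinfun (\<lambda>v. \<nu> (\<phi>' v *\<^sub>R P x \<mu> + \<phi>0 *\<^sub>R DQ x \<mu> v)
        - (\<phi>' (P x \<nu>) * \<mu> v - \<phi>' v * \<mu> (P x \<nu>))))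
      = \<phi>0 *\<^sub>R DQ x \<nu> (P x \<mu>) - (\<phi>' (P x \<nu>) *\<^sub>R P x \<mu> + \<phi>0 *\<^sub>R DQ x \<mu> (P x \<nu>))"
    if K: "compact K" "K \<subseteq> snd (chart_at A x) ` fst (chart_at A x)"
      and \<phi>: "smooth_on UNIV \<phi>" "\<And>y. y \<notin> K \<Longrightarrow> \<phi> y = 0" "\<phi> (snd (chart_at A x) x) = \<phi>0"
        "(\<phi> has_derivative \<phi>') (at (snd (chart_at A x) x))"
      and \<psi>: "smooth_on UNIV \<psi>" "\<And>y. y \<notin> K \<Longrightarrow> \<psi> y = 0" "\<psi> (snd (chart_at A x) x) = 1"
        "(\<psi> has_derivative (\<lambda>v. 0)) (at (snd (chart_at A x) x))"
    for x K \<phi>0 \<phi>' and \<phi> \<psi> :: "'b \<Rightarrow> real" and \<mu> \<nu> :: "'b \<Rightarrow>\<^sub>L real"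
  proof -
    define c where "c = chart_at A x"
    define y0 where "y0 = snd c x"
    let ?S = "snd c ` fst c"
    have c: "c \<in> A" "x \<in> fst c" unfolding c_def by (rule chart_at[OF M])+
    have S: "open ?S" "y0 \<in> ?S" using chart_open_image[OF M c(1)] c(2) by (auto simp: y0_def)
    have self: "\<omega> o\<^sub>L coord_change c c x = \<omega>" for \<omega> :: "'b \<Rightarrow>\<^sub>L real"
      using coord_change_self[OF M c] by (simp add: blinfun_eqI)
    have at: "local_form A c \<kappa> \<omega> x = \<kappa> y0 *\<^sub>R \<omega>" for \<kappa> \<omega>
      using c by (simp add: local_form_def self c_def[symmetric] y0_def)
    \<comment> \<open>Both formulas hold on the whole chart image, an open set, and so may be
      differentiated at \<open>y0\<close>.\<close>
    have form: "form1_in A c (local_form A c \<kappa> \<omega>) y = \<kappa> y *\<^sub>R \<omega>"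
      and vf: "vf_in A c (\<lambda>z. P z (local_form A c \<kappa> \<omega> z)) y = \<kappa> y *\<^sub>R Q c y \<omega>"
      if y: "y \<in> ?S" for \<kappa> \<omega> y
    proof -
      obtain z where z: "z \<in> fst c" "y = snd c z" using y by blast
      have inv: "chart_inv c (snd c z) = z" using z chart_inv_left[OF M c(1)] by simp
      have "\<omega> o\<^sub>L coord_change (chart_at A z) c z o\<^sub>L coord_change c (chart_at A z) z = \<omega>"
        using coord_change_inverse[OF M c(1) chart_at(1)[OF M] z(1) chart_at(2)[OF M]]
        by (simp add: blinfun_eqI)
      then show "form1_in A c (local_form A c \<kappa> \<omega>) y = \<kappa> y *\<^sub>R \<omega>"
        using z by (simp add: form1_in_def Let_def inv local_form_def
            bounded_bilinear.scaleR_left[OF bounded_bilinear_blinfun_compose])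
      show "vf_in A c (\<lambda>z. P z (local_form A c \<kappa> \<omega> z)) y = \<kappa> y *\<^sub>R Q c y \<omega>"
        using z by (simp add: vf_in_def Q_def Let_def inv local_form_def lin_simps blinfun.scaleR_right)
    qed
    have Dform: "frechet_derivative (form1_in A c (local_form A c \<kappa> \<omega>)) (at y0) = (\<lambda>u. \<kappa>' u *\<^sub>R \<omega>)"
      if "(\<kappa> has_derivative \<kappa>') (at y0)" for \<kappa> \<kappa>' \<omega>
    proof (rule frechet_derivativeI, rule has_derivative_transform_within_open[OF _ S])
      show "((\<lambda>y. \<kappa> y *\<^sub>R \<omega>) has_derivative (\<lambda>u. \<kappa>' u *\<^sub>R \<omega>)) (at y0)"
        using that by (rule has_derivative_scaleR_left)
    qed (simp add: form)
    have Dvf: "frechet_derivative (vf_in A c (\<lambda>z. P z (local_form A c \<kappa> \<omega> z))) (at y0) =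
        (\<lambda>u. \<kappa>' u *\<^sub>R P x \<omega> + \<kappa> y0 *\<^sub>R DQ x \<omega> u)"
      if "(\<kappa> has_derivative \<kappa>') (at y0)" for \<kappa> \<kappa>' \<omega>
    proof (rule frechet_derivativeI, rule has_derivative_transform_within_open[OF _ S])
      have "((\<lambda>y. \<kappa> y *\<^sub>R Q c y \<omega>) has_derivative
          (\<lambda>u. \<kappa> y0 *\<^sub>R DQ x \<omega> u + \<kappa>' u *\<^sub>R Q c y0 \<omega>)) (at y0)"
        using that DQ[of x \<omega>] by (intro has_derivative_scaleR) (simp_all add: c_def[symmetric] y0_def)
      moreover have "Q c y0 \<omega> = P x \<omega>" using Q0[of x \<omega>] by (simp add: c_def y0_def)
      ultimately show "((\<lambda>y. \<kappa> y *\<^sub>R Q c y \<omega>) has_derivative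
          (\<lambda>u. \<kappa>' u *\<^sub>R P x \<omega> + \<kappa> y0 *\<^sub>R DQ x \<omega> u)) (at y0)"
        by (simp add: add.commute)
    qed (simp add: vf)
    note \<phi> = \<phi>[folded c_def, folded y0_def] and \<psi> = \<psi>[folded c_def, folded y0_def]
    let ?\<alpha> = "local_form A c \<phi> \<mu>" and ?\<beta> = "local_form A c \<psi> \<nu>"
    have forms: "one_form A ?\<alpha>" "one_form A ?\<beta>"
      using one_form_local_form[OF M c(1) K[folded c_def]] \<phi> \<psi> by auto
    have "lie_deriv1 A (\<lambda>x. P x (?\<alpha> x)) ?\<beta> x v - ext_deriv1 A ?\<alpha> x (P x (?\<beta> x)) v =
        \<nu> (\<phi>' v *\<^sub>R P x \<mu> + \<phi>0 *\<^sub>R DQ x \<mu> v) - (\<phi>' (P x \<nu>) * \<mu> v - \<phi>' v * \<mu> (P x \<nu>))" for v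
      by (simp add: lie_deriv1_def ext_deriv1_def Let_def c_def[symmetric] y0_def[symmetric] at
          Dform[OF \<psi>(4)] Dform[OF \<phi>(4)] Dvf[OF \<phi>(4)] \<phi>(3) \<psi>(3) blinfun.bilinear_simps)
    moreover have "lie_bracket A (\<lambda>x. P x (?\<alpha> x)) (\<lambda>x. P x (?\<beta> x)) x =
        \<phi>0 *\<^sub>R DQ x \<nu> (P x \<mu>) - (\<phi>' (P x \<nu>) *\<^sub>R P x \<mu> + \<phi>0 *\<^sub>R DQ x \<mu> (P x \<nu>))"
      by (simp add: lie_bracket_def Let_def c_def[symmetric] y0_def[symmetric] at
          Dvf[OF \<phi>(4)] Dvf[OF \<psi>(4)] \<phi>(3) \<psi>(3) lin_simps linear_cmul[OF linDQ])
    ultimately show ?thesis using star[OF forms, of x] by simp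
  qed

  have bump: "\<exists>K f. compact K \<and> K \<subseteq> snd (chart_at A x) ` fst (chart_at A x) \<and> smooth_on UNIV f \<and>
      (\<forall>y. y \<notin> K \<longrightarrow> f y = (0::real)) \<and> f (snd (chart_at A x) x) = 1 \<and>
      (f has_derivative (\<lambda>v. 0)) (at (snd (chart_at A x) x))" for x
  proof -
    let ?c = "chart_at A x"
    have "open (snd ?c ` fst ?c)" "snd ?c x \<in> snd ?c ` fst ?c"
      using chart_open_image[OF M chart_at(1)[OF M]] chart_at(2)[OF M] by auto
    then obtain r where r: "r > 0" "cball (snd ?c x) r \<subseteq> snd ?c ` fst ?c"
      by (meson open_contains_cball)
    obtain f where "smooth_on UNIV f" "f (snd ?c x) = 1" "(f has_derivative (\<lambda>v. 0)) (at (snd ?c x))"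
      "\<And>y. y \<notin> cball (snd ?c x) r \<Longrightarrow> f y = (0::real)"
      using bump_function[OF r(1)] by blast
    then show ?thesis using r by (intro exI[of _ "cball (snd ?c x) r"] exI[of _ f]) simp
  qed

  have skew: "\<nu> (P x \<mu>) = - \<mu> (P x \<nu>)" for x and \<mu> \<nu> :: "'b \<Rightarrow>\<^sub>L real"
  proof -
    let ?g = "\<nu> (P x \<mu>) + \<mu> (P x \<nu>)"
    have "?g *\<^sub>R P x l = 0" for l :: "'b \<Rightarrow>\<^sub>L real"
    proof -
      let ?y0 = "snd (chart_at A x) x"
      obtain K f where K: "compact K" "K \<subseteq> snd (chart_at A x) ` fst (chart_at A x)"
        and f: "smooth_on UNIV f" "\<And>y. y \<notin> K \<Longrightarrow> f y = (0::real)" "f ?y0 = 1"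
          "(f has_derivative (\<lambda>v. 0)) (at ?y0)"
        using bump[of x] by blast
      \<comment> \<open>The first factor vanishes at the point and has derivative \<open>l\<close>,
        while \<open>f\<close> equals 1 there: the product has value 0 and derivative
        \<open>l\<close>.\<close>
      let ?\<phi> = "\<lambda>y. (l y + - l ?y0) * f y"
      have sm: "smooth_on UNIV ?\<phi>"
        by (intro smooth_on_bilinear[OF bounded_bilinear_mult] smooth_on_add smooth_on_const f(1)
            smooth_on_linear[OF blinfun.bounded_linear_right] open_UNIV)
      have "((\<lambda>y. l y + - l ?y0) has_derivative (\<lambda>v. l v + 0)) (at ?y0)"
        by (intro has_derivative_add has_derivative_const
            bounded_linear_imp_has_derivative[OF blinfun.bounded_linear_right])
      from has_derivative_mult[OF this f(4)]
      have "(?\<phi> has_derivative blinfun_apply l) (at ?y0)" by (simp add: f(3))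
      from key[OF K sm _ _ this f, of 0 \<nu> \<mu>] f(2)
      have "P x (Blinfun (\<lambda>v. \<nu> (l v *\<^sub>R P x \<mu>) - (l (P x \<nu>) * \<mu> v - l v * \<mu> (P x \<nu>)))) =
          - (l (P x \<nu>) *\<^sub>R P x \<mu>)"
        by simp
      moreover have "Blinfun (\<lambda>v. \<nu> (l v *\<^sub>R P x \<mu>) - (l (P x \<nu>) * \<mu> v - l v * \<mu> (P x \<nu>))) =
          ?g *\<^sub>R l - l (P x \<nu>) *\<^sub>R \<mu>"
      proof (rule blinfun_eqI)
        have "linear (\<lambda>v. \<nu> (l v *\<^sub>R P x \<mu>) - (l (P x \<nu>) * \<mu> v - l v * \<mu> (P x \<nu>)))"
          by (rule linearI) (simp_all add: blinfun.bilinear_simps algebra_simps)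
        then show "blinfun_apply (Blinfun (\<lambda>v. \<nu> (l v *\<^sub>R P x \<mu>) - (l (P x \<nu>) * \<mu> v - l v * \<mu> (P x \<nu>)))) i =
            (?g *\<^sub>R l - l (P x \<nu>) *\<^sub>R \<mu>) i" for i
          by (simp add: blinfun_apply_Blinfun_linear blinfun.bilinear_simps algebra_simps)
      qed
      ultimately show ?thesis by (simp add: lin_simps)
    qed
    \<comment> \<open>If \<open>?g\<close> is nonzero, then \<open>P x\<close> vanishes identically
      and skewness at \<open>x\<close> is trivial.\<close>
    then have "?g = 0 \<or> (\<forall>l. P x l = 0)" by auto
    then show ?thesis by (auto simp: blinfun.bilinear_simps)
  qed
  have skewQ: "\<nu> (Q c y \<mu>) = - \<mu> (Q c y \<nu>)" for c y and \<mu> \<nu> :: "'b \<Rightarrow>\<^sub>L real"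
  proof -
    define z where "z = chart_inv c y"
    define d where "d = coord_change (chart_at A z) c z"
    have "(\<nu> o\<^sub>L d) (P z (\<mu> o\<^sub>L d)) = - (\<mu> o\<^sub>L d) (P z (\<nu> o\<^sub>L d))" by (rule skew)
    then show ?thesis by (simp add: Q_def Let_def z_def d_def)
  qed
  have DQ_apply: "((\<lambda>y. \<nu> (Q (chart_at A x) y \<mu>)) has_derivative (\<lambda>v. \<nu> (DQ x \<mu> v)))
      (at (snd (chart_at A x) x))" for x and \<mu> \<nu> :: "'b \<Rightarrow>\<^sub>L real"
    by (rule bounded_linear.has_derivative[OF blinfun.bounded_linear_right DQ])
  \<comment> \<open>Skewness holds at every point, so it may be differentiated.\<close>
  have skewDQ: "\<nu> (DQ x \<mu> v) = - \<mu> (DQ x \<nu> v)" for x v and \<mu> \<nu> :: "'b \<Rightarrow>\<^sub>L real"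
  proof -
    have "((\<lambda>y. \<nu> (Q (chart_at A x) y \<mu>)) has_derivative (\<lambda>v. - \<mu> (DQ x \<nu> v)))
        (at (snd (chart_at A x) x))"
      unfolding skewQ[of \<nu> _ _ \<mu>] by (rule has_derivative_minus[OF DQ_apply])
    from has_derivative_unique[OF DQ_apply this] show ?thesis by (rule fun_cong)
  qed
  have biv_deriv: "frechet_derivative (\<lambda>y. bivector_in A (chart_at A x) P y \<mu> \<nu>)
      (at (snd (chart_at A x) x)) v = \<nu> (DQ x \<mu> v)" for x v and \<mu> \<nu> :: "'b \<Rightarrow>\<^sub>L real"
    using frechet_derivativeI[OF DQ_apply] by (simp add: biv)
  have jacobi: "\<gamma> (DQ x \<beta> (P x \<alpha>)) + \<alpha> (DQ x \<gamma> (P x \<beta>)) + \<beta> (DQ x \<alpha> (P x \<gamma>)) = 0" for x and \<alpha> \<beta> \<gamma> :: "'b \<Rightarrow>\<^sub>L real"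
  proof -
    let ?y0 = "snd (chart_at A x) x"
    obtain K f where K: "compact K" "K \<subseteq> snd (chart_at A x) ` fst (chart_at A x)"
      and f: "smooth_on UNIV f" "\<And>y. y \<notin> K \<Longrightarrow> f y = (0::real)" "f ?y0 = 1"
        "(f has_derivative (\<lambda>v. 0)) (at ?y0)"
      using bump[of x] by blast
    \<comment> \<open>Both forms are cut off by the same bump, so all terms with a derivative of the
      coefficients vanish at \<open>x\<close>.\<close>
    from key[OF K f f, of \<beta> \<alpha>]
    have "P x (Blinfun (\<lambda>v. \<beta> (DQ x \<alpha> v))) = DQ x \<beta> (P x \<alpha>) - DQ x \<alpha> (P x \<beta>)"
      by simp
    \<comment> \<open>Pairing with \<open>\<gamma>\<close> and moving \<open>P\<close> across by
      skewness removes the outer \<open>P\<close> and produces the third cyclic term.\<close>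
    then have "\<gamma> (DQ x \<beta> (P x \<alpha>) - DQ x \<alpha> (P x \<beta>)) = - Blinfun (\<lambda>v. \<beta> (DQ x \<alpha> v)) (P x \<gamma>)"
      using skew by metis
    also have "linear (\<lambda>v. \<beta> (DQ x \<alpha> v))"
      using linear_compose[OF linDQ bounded_linear.linear[OF blinfun.bounded_linear_right]]
      by (simp add: o_def)
    then have "Blinfun (\<lambda>v. \<beta> (DQ x \<alpha> v)) (P x \<gamma>) = \<beta> (DQ x \<alpha> (P x \<gamma>))"
      by (simp add: blinfun_apply_Blinfun_linear)
    finally show ?thesis
      using skewDQ[of \<gamma> x \<alpha> "P x \<beta>"] by (simp add: blinfun.bilinear_simps)
  qed
  show ?thesis
    unfolding poisson_bivector_def bivector_field_def
  proof (intro conjI allI bm skew)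
    \<comment> \<open>With equal arguments every term of the Schouten bracket occurs twice, so it is
      twice the cyclic sum in \<open>jacobi\<close>.\<close>
    show "schouten_bracket A P P x \<alpha> \<beta> \<gamma> = 0" for x \<alpha> \<beta> \<gamma>
      using jacobi[of \<gamma> x \<beta> \<alpha>] by (simp add: schouten_bracket_def Let_def biv_deriv)
  qed
qed

end

section \<open>Generalized complex structures\<close>

text \<open>Brings an arbitrary section into the form required by the bracket formula. Exactness
  yields \<open>\<xi>\<close> point by point only; its smoothness follows since the pairing with the
  image of the splitting recovers \<open>\<xi>\<close>.\<close>

lemma smooth_section_splitting:
  fixes A :: "('m::{t2_space, second_countable_topology}, 'b::euclidean_space) chart set"
    and E :: "('m, 'e::real_vector, 'f::real_normed_vector) vbundle"
  assumes M: "smooth_manifold A" and E: "vector_bundle A E"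
    and ip: "bundle_inner_product A E ip"
    and anc: "bundle_map A E (tangent_bundle A) anc"
    and inc: "bundle_map A (cotangent_bundle A) E inc"
    and ker: "\<And>x. range (inc x) = {e \<in> fiber E x. anc x e = 0}"
    and s: "bundle_map A (tangent_bundle A) E s" "\<And>x v. anc x (s x v) = v"
    and pairing: "\<And>x X \<xi> Y \<eta>. ip x (s x X + inc x \<xi>) (s x Y + inc x \<eta>) =
      (1/2) * (blinfun_apply \<xi> Y + blinfun_apply \<eta> X)"
    and \<sigma>: "smooth_section A E \<sigma>"
  obtains \<xi> where "one_form A \<xi>" "\<sigma> = (\<lambda>x. s x (anc x (\<sigma> x)) + inc x (\<xi> x))"
proof -
  note T = tangent_bundle(1)[OF M]
  let ?X = "\<lambda>x. anc x (\<sigma> x)" and ?\<tau> = "\<lambda>x. \<sigma> x - s x (anc x (\<sigma> x))"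
  have X: "vector_field A ?X" by (rule smooth_section_bundle_map[OF M E T anc \<sigma>])
  have \<tau>: "smooth_section A E ?\<tau>"
    by (rule smooth_section_diff[OF M E \<sigma> smooth_section_bundle_map[OF M T E s(1) X]])
  have s_fib: "s x v \<in> fiber E x" for x v
    using linear_betweenD(1)[OF bundle_mapD(1)[OF s(1)]] by simp
  have "?\<tau> x \<in> range (inc x)" for x
    using smooth_sectionD(1)[OF \<tau>, of x] smooth_sectionD(1)[OF \<sigma>, of x] s_fib s(2)
      linear_between_diff[OF bundle_mapD(1)[OF anc] vector_bundle_fiber[OF E], of "\<sigma> x" x "s x (?X x)"]
    by (simp add: ker)
  then have "\<exists>\<omega>. ?\<tau> x = inc x \<omega>" for x by blast
  then obtain \<xi> where \<xi>: "\<And>x. ?\<tau> x = inc x (\<xi> x)" by metis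
  have zero: "s x 0 = 0" "inc x 0 = 0" for x
    using linear_between_zero[OF bundle_mapD(1)[OF s(1)]] linear_between_zero[OF bundle_mapD(1)[OF inc]]
    by simp_all
  \<comment> \<open>The factor 2 cancels the 1/2 in the inner product; the splitting is isotropic,
    so only the form contributes.\<close>
  have \<xi>_eq: "\<xi> x v = 2 * ip x (?\<tau> x) (s x v)" for x v
    using pairing[of x 0 "\<xi> x" v 0] by (simp add: zero \<xi>)
  have "one_form A \<xi>"
    unfolding one_form_iff[OF M]
  proof (intro ballI smooth_fun_blinfun_real[OF M] chart_open[OF M])
    fix c v assume c: "c \<in> A"
    \<comment> \<open>The image under \<open>s\<close> of the coordinate vector field of the chart
      \<open>c\<close> with constant components \<open>v\<close>.\<close>
    let ?v = "\<lambda>x. s x (triv_inv (tangent_bundle A) (tangent_triv A c) x v)"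
    show "smooth_fun A (fst c) (\<lambda>x. cotangent_triv A c x (\<xi> x) v)"
    proof (rule smooth_fun_local[OF M])
      fix x assume x: "x \<in> fst c"
      obtain U t where U: "(U, t) \<in> trivs E" "x \<in> U" "open U" by (rule vector_bundle_triv_at[OF E])
      have o: "open (fst c \<inter> U)" using U(3) chart_open[OF M c] by blast
      have "smooth_fun A (fst c \<inter> U) (\<lambda>x. t x (?v x))"
        by (rule bundle_mapD(2)[OF s(1)]) (use c U in \<open>auto simp: trivs_tangent_bundle\<close>)
      then have "smooth_fun A (fst c \<inter> U) (\<lambda>x. ip x (?\<tau> x) (?v x))"
        by (intro smooth_fun_inner_product[OF M E U(1) ip o])
          (use smooth_sectionD(1)[OF \<tau>] s_fib
            smooth_fun_subset[OF M smooth_sectionD(2)[OF \<tau> U(1)] Int_lower2] in auto)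
      from smooth_fun_linear_compose[OF M bounded_linear_mult_right[of 2] o this]
      have "smooth_fun A (fst c \<inter> U) (\<lambda>x. cotangent_triv A c x (\<xi> x) v)"
        by (rule smooth_fun_cong[OF M _ o])
          (simp add: cotangent_triv_def \<xi>_eq tangent_bundle(2)[OF M c])
      then show "\<exists>V. open V \<and> x \<in> V \<and> smooth_fun A V (\<lambda>x. cotangent_triv A c x (\<xi> x) v)"
        using o x U by blast
    qed
  qed
  moreover have "\<sigma> = (\<lambda>x. s x (?X x) + inc x (\<xi> x))"
    using \<xi> by (simp add: fun_eq_iff algebra_simps)
  ultimately show ?thesis by (rule that)
qed

text \<open>In [J\<alpha>, \<beta>] and [\<alpha>, J\<beta>] one vector part is zero. This kills the
  \<open>H\<close> term and the derivatives of the form parts of J\<alpha> and J\<beta>, and leaves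
  the one-forms L_{P\<alpha>}\<beta> and -i_{P\<beta>}d\<alpha>. In [J\<alpha>, J\<beta>] all these
  terms lie in T^*, where the anchor vanishes.\<close>

lemma generalized_complex_anchor_identity:
  fixes A :: "('m::{t2_space, second_countable_topology}, 'b::euclidean_space) chart set"
    and E :: "('m, 'e::real_vector, 'f::real_normed_vector) vbundle"
  assumes M: "smooth_manifold A"
    and C: "exact_courant_algebroid A E ip br anc inc"
    and G: "generalized_complex_structure A E br J"
    and \<alpha>: "one_form A \<alpha>" and \<beta>: "one_form A \<beta>"
  defines "P \<equiv> \<lambda>x \<alpha>. anc x (J x (inc x \<alpha>))"
  shows "P x (Blinfun (\<lambda>v. lie_deriv1 A (\<lambda>x. P x (\<alpha> x)) \<beta> x v - ext_deriv1 A \<alpha> x (P x (\<beta> x)) v)) =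
      lie_bracket A (\<lambda>x. P x (\<alpha> x)) (\<lambda>x. P x (\<beta> x)) x"
proof -
  have E: "vector_bundle A E" and ip: "bundle_inner_product A E ip"
    and anc: "bundle_map A E (tangent_bundle A) anc"
    and inc: "bundle_map A (cotangent_bundle A) E inc"
    and ker: "range (inc x) = {e \<in> fiber E x. anc x e = 0}" for x
    using C by (simp_all add: exact_courant_algebroid_def)
  obtain s H where iso: "isotropic_splitting A E ip anc s" and H: "closed_three_form A H"
    and pairing: "\<forall>x X \<xi> Y \<eta>. ip x (s x X + inc x \<xi>) (s x Y + inc x \<eta>) =
      (1/2) * (blinfun_apply \<xi> Y + blinfun_apply \<eta> X)"
    and br': "\<forall>X \<xi> Y \<eta>. vector_field A X \<and> one_form A \<xi> \<and> vector_field A Y \<and> one_form A \<eta> \<longrightarrow>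
      br (\<lambda>x. s x (X x) + inc x (\<xi> x)) (\<lambda>x. s x (Y x) + inc x (\<eta> x)) =
      (\<lambda>x. s x (lie_bracket A X Y x) + inc x (courant_form_part A H X \<xi> Y \<eta> x))"
    using C unfolding exact_courant_algebroid_def by (elim conjE exE) (rule that)
  note br = br'[rule_format, OF conjI[OF _ conjI[OF _ conjI]]]
  have s: "bundle_map A (tangent_bundle A) E s" "\<And>x v. anc x (s x v) = v"
    using iso by (simp_all add: isotropic_splitting_def)
  have J: "bundle_map A E E J" and J2: "\<And>x e. e \<in> fiber E x \<Longrightarrow> J x (J x e) = - e"
    and inv: "\<And>\<sigma> \<tau>. \<sigma> \<in> eigenbundle_sections A E J \<Longrightarrow> \<tau> \<in> eigenbundle_sections A E J \<Longrightarrow>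
      complex_bracket br \<sigma> \<tau> \<in> eigenbundle_sections A E J"
    using G by (simp_all add: generalized_complex_structure_def)
  have s_fib: "s x v \<in> fiber E x" and inc_fib: "inc x \<omega> \<in> fiber E x" for x v \<omega>
    using linear_betweenD(1)[OF bundle_mapD(1)[OF s(1)]] linear_betweenD(1)[OF bundle_mapD(1)[OF inc]]
    by simp_all
  have anc_split: "anc x (s x v + inc x \<omega>) = v" for x v \<omega>
  proof -
    have "anc x (inc x \<omega>) = 0" using ker by blast
    then show ?thesis
      using linear_betweenD(2)[OF bundle_mapD(1)[OF anc] s_fib inc_fib] s(2) by simp
  qed
  have s0: "s x 0 = 0" for x
    using linear_between_zero[OF bundle_mapD(1)[OF s(1)]] by simp
  have inc_add: "inc x (\<omega> + \<omega>') = inc x \<omega> + inc x \<omega>'" for x \<omega> \<omega>'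
    using linear_betweenD(2)[OF bundle_mapD(1)[OF inc]] by simp
  \<comment> \<open>\<open>three_form\<close> states linearity for the first slot; the second
    follows by antisymmetry.\<close>
  have H0: "H x 0 u v = 0" "H x u 0 v = 0" for x u v
  proof -
    have H': "linear (\<lambda>u. H x u v w) \<and> H x v u w = - H x u v w \<and> H x u w v = - H x u v w" for u v w
      by (rule conjunct1[OF conjunct1[OF H[unfolded closed_three_form_def three_form_def]], rule_format])
    show "H x 0 u v = 0" for u v using linear_0[OF conjunct1[OF H']] .
    then show "H x u 0 v = 0" using H'[where u = 0 and v = u and w = v] by simp
  qed
  note vf0 = smooth_section_zero[OF M tangent_bundle(1)[OF M]]
  have sec_inc: "smooth_section A E (\<lambda>x. inc x (\<omega> x))" if "one_form A \<omega>" for \<omega>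
    by (rule smooth_section_bundle_map[OF M cotangent_bundle(1)[OF M] E inc that])
  have sec_J: "smooth_section A E (\<lambda>x. J x (inc x (\<omega> x)))" if "one_form A \<omega>" for \<omega>
    by (rule smooth_section_bundle_map[OF M E E J sec_inc[OF that]])
  have vf: "vector_field A (\<lambda>x. P x (\<omega> x))" if "one_form A \<omega>" for \<omega>
    unfolding P_def by (rule smooth_section_bundle_map[OF M E tangent_bundle(1)[OF M] anc sec_J[OF that]])
  have split: "\<exists>\<xi>. one_form A \<xi> \<and> (\<lambda>x. J x (inc x (\<omega> x))) = (\<lambda>x. s x (P x (\<omega> x)) + inc x (\<xi> x))"
    if "one_form A \<omega>" for \<omega>
    unfolding P_def
    by (rule smooth_section_splitting[OF M E ip anc inc ker s pairing[rule_format] sec_J[OF that]]) blast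
  have eigen: "(\<lambda>x. J x (inc x (\<omega> x)), \<lambda>x. inc x (\<omega> x)) \<in> eigenbundle_sections A E J"
    if "one_form A \<omega>" for \<omega>
    by (simp add: eigenbundle_sections_def sec_inc[OF that] sec_J[OF that] J2 inc_fib)
  \<comment> \<open>Adds a zero vector part so that the bracket formula matches.\<close>
  have inc_split: "(\<lambda>x. inc x (\<omega> x)) = (\<lambda>x. s x 0 + inc x (\<omega> x))" for \<omega>
    by (simp add: s0)
  obtain \<xi> where \<xi>: "one_form A \<xi>" "(\<lambda>x. J x (inc x (\<alpha> x))) = (\<lambda>x. s x (P x (\<alpha> x)) + inc x (\<xi> x))"
    using split[OF \<alpha>] by blast
  obtain \<eta> where \<eta>: "one_form A \<eta>" "(\<lambda>x. J x (inc x (\<beta> x))) = (\<lambda>x. s x (P x (\<beta> x)) + inc x (\<eta> x))"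
    using split[OF \<beta>] by blast
  let ?X = "\<lambda>x. P x (\<alpha> x)" and ?Y = "\<lambda>x. P x (\<beta> x)"
  let ?a = "\<lambda>x. inc x (\<alpha> x)" and ?b = "\<lambda>x. inc x (\<beta> x)"
  let ?Ja = "\<lambda>x. J x (?a x)" and ?Jb = "\<lambda>x. J x (?b x)"
  have linL: "linear (lie_deriv1 A ?X \<beta> x)" by (rule linear_lie_deriv1[OF M vf[OF \<alpha>]])
  have linE: "linear (ext_deriv1 A \<alpha> x (?Y x))" by (rule linear_ext_deriv1[OF M \<alpha>])
  have br_JJ: "br ?Ja ?Jb x = s x (lie_bracket A ?X ?Y x) + inc x (courant_form_part A H ?X \<xi> ?Y \<eta> x)"
    unfolding \<xi>(2) \<eta>(2) br[OF vf[OF \<alpha>] \<xi>(1) vf[OF \<beta>] \<eta>(1)] ..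
  have br_ab: "br ?a ?b x = s x 0 + inc x (courant_form_part A H (\<lambda>x. 0) \<alpha> (\<lambda>x. 0) \<beta> x)"
    unfolding inc_split[of \<alpha>] inc_split[of \<beta>] br[OF vf0 \<alpha> vf0 \<beta>] lie_bracket_zero(1)[OF M vf0] ..
  have "br ?Ja ?b x = s x 0 + inc x (courant_form_part A H ?X \<xi> (\<lambda>x. 0) \<beta> x)"
    unfolding \<xi>(2) inc_split[of \<beta>] br[OF vf[OF \<alpha>] \<xi>(1) vf0 \<beta>] lie_bracket_zero(1)[OF M vf[OF \<alpha>]] ..
  also have "courant_form_part A H ?X \<xi> (\<lambda>x. 0) \<beta> x = Blinfun (lie_deriv1 A ?X \<beta> x)"
    by (simp add: courant_form_part_def H0 ext_deriv1_zero[OF M \<xi>(1)])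
  finally have br_Jab: "br ?Ja ?b x = inc x (Blinfun (lie_deriv1 A ?X \<beta> x))" by (simp add: s0)
  have "br ?a ?Jb x = s x 0 + inc x (courant_form_part A H (\<lambda>x. 0) \<alpha> ?Y \<eta> x)"
    unfolding \<eta>(2) inc_split[of \<alpha>] br[OF vf0 \<alpha> vf[OF \<beta>] \<eta>(1)] lie_bracket_zero(2)[OF M vf[OF \<beta>]] ..
  also have "courant_form_part A H (\<lambda>x. 0) \<alpha> ?Y \<eta> x = Blinfun (\<lambda>v. - ext_deriv1 A \<alpha> x (?Y x) v)"
    by (simp add: courant_form_part_def H0 lie_deriv1_zero[OF M \<eta>(1)])
  finally have br_aJb: "br ?a ?Jb x = inc x (Blinfun (\<lambda>v. - ext_deriv1 A \<alpha> x (?Y x) v))"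
    by (simp add: s0)
  \<comment> \<open>For a section a + ib of the eigenbundle, \<open>J\<close> maps the imaginary
    part to the real part; here these are the two parts of the complex bracket.\<close>
  have "J x (br ?Ja ?b x + br ?a ?Jb x) = br ?Ja ?Jb x - br ?a ?b x"
    using inv[OF eigen[OF \<alpha>] eigen[OF \<beta>]] by (simp add: complex_bracket_def eigenbundle_sections_def)
  then have "P x (Blinfun (lie_deriv1 A ?X \<beta> x) + Blinfun (\<lambda>v. - ext_deriv1 A \<alpha> x (?Y x) v)) =
      anc x (br ?Ja ?Jb x - br ?a ?b x)"
    by (simp add: P_def br_Jab br_aJb inc_add)
  \<comment> \<open>\<open>Blinfun\<close> is additive here because both operands are linear in
    \<open>v\<close>.\<close>
  also have "Blinfun (lie_deriv1 A ?X \<beta> x) + Blinfun (\<lambda>v. - ext_deriv1 A \<alpha> x (?Y x) v) =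
      Blinfun (\<lambda>v. lie_deriv1 A ?X \<beta> x v - ext_deriv1 A \<alpha> x (?Y x) v)"
    by (rule blinfun_eqI) (simp add: plus_blinfun.rep_eq blinfun_apply_Blinfun_linear linL
        linear_compose_neg[OF linE] linear_compose_sub[OF linL linE])
  also have "anc x (br ?Ja ?Jb x - br ?a ?b x) = anc x (br ?Ja ?Jb x) - anc x (br ?a ?b x)"
    unfolding br_JJ br_ab
    by (rule linear_between_diff[OF bundle_mapD(1)[OF anc] vector_bundle_fiber[OF E]])
      (simp_all add: subspace_add vector_bundle_fiber[OF E] s_fib inc_fib)
  also have "\<dots> = lie_bracket A ?X ?Y x"
    unfolding br_JJ br_ab anc_split by simp
  finally show ?thesis .
qed

theorem proposition3p24:
  fixes A :: "('m::{t2_space, second_countable_topology}, 'b::euclidean_space) chart set"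
    and E :: "('m, 'e::real_vector, 'f::real_normed_vector) vbundle"
    and ip :: "'m \<Rightarrow> 'e \<Rightarrow> 'e \<Rightarrow> real"
    and br :: "('m \<Rightarrow> 'e) \<Rightarrow> ('m \<Rightarrow> 'e) \<Rightarrow> 'm \<Rightarrow> 'e"
    and anc :: "'m \<Rightarrow> 'e \<Rightarrow> 'b"
    and inc :: "'m \<Rightarrow> ('b \<Rightarrow>\<^sub>L real) \<Rightarrow> 'e"
    and J :: "'m \<Rightarrow> 'e \<Rightarrow> 'e"
  assumes "smooth_manifold A"
    and "exact_courant_algebroid A E ip br anc inc"
    and "generalized_complex_structure A E br J"
  shows "poisson_bivector A (\<lambda>x \<alpha>. anc x (J x (inc x \<alpha>)))"
proof (rule poisson_bivectorI[OF assms(1)])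
  note M = assms(1)
  have E: "vector_bundle A E" and anc: "bundle_map A E (tangent_bundle A) anc"
    and inc: "bundle_map A (cotangent_bundle A) E inc" and J: "bundle_map A E E J"
    using assms by (simp_all add: exact_courant_algebroid_def generalized_complex_structure_def)
  note T = tangent_bundle(1)[OF M] and T' = cotangent_bundle(1)[OF M]
  show "bundle_map A (cotangent_bundle A) (tangent_bundle A) (\<lambda>x \<alpha>. anc x (J x (inc x \<alpha>)))"
    by (rule bundle_map_compose[OF M T' E T bundle_map_compose[OF M T' E E inc J] anc])
qed (rule generalized_complex_anchor_identity[OF assms])

end
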